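(* If $C$ is a centrally symmetric convex $n$-gon (thus $n$ is even), then its geometric dilation satisfies $$\delta(C)\ge\frac n2\tan\frac{\pi}{n}.$$ This bound is tight, i.e. for each even $n\ge 4$ equality is attained by some centrally symmetric convex $n$-gon.
   Context: A polygon is regarded as the closed curve formed by its boundary. The geometric dilation of a simple closed curve $C$ is $\delta(C)=\sup_{p\neq q\in C} d_C(p,q)/|pq|$, where $d_C(p,q)$ is the length of the shorter arc of $C$ between $p$ and $q$ and $|pq|$ is the Euclidean distance. *)

theory Defs
  imports "HOL-Analysis.Analysis"
begin

text \<open>
  The Euclidean plane is represented by the type \<^typ>\<open>complex\<close>, and a polygon by the point set of
  its boundary curve. Lengths take values in \<^typ>\<open>ereal\<close>, so that the suprema below are
  meaningful without rectifiability or boundedness assumptions.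
\<close>

definition curve_length :: "(real \<Rightarrow> 'a::metric_space) \<Rightarrow> ereal" where
  "curve_length g =
     (SUP (k, t) \<in> {(k, t). mono_on {..k} t \<and> t ` {..k} \<subseteq> {0..1}}.
        ereal (\<Sum>i<k. dist (g (t i)) (g (t (Suc i)))))"

text \<open>
  If \<open>C\<close> is a simple closed curve and \<open>p \<noteq> q\<close> are points of \<open>C\<close>, then up to reparametrization
  exactly two arcs inside \<open>C\<close> lead from \<open>p\<close> to \<open>q\<close>, and reparametrization does not change the
  length; hence the infimum is the length of the shorter of the two.
\<close>

definition arc_dist :: "'a::metric_space set \<Rightarrow> 'a \<Rightarrow> 'a \<Rightarrow> ereal" where
  "arc_dist C p q =
     (INF g \<in> {g. arc g \<and> path_image g \<subseteq> C \<and> pathstart g = p \<and> pathfinish g = q}. curve_length g)"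

definition geometric_dilation :: "'a::metric_space set \<Rightarrow> ereal" where
  "geometric_dilation C =
     (SUP (p, q) \<in> {(p, q). p \<in> C \<and> q \<in> C \<and> p \<noteq> q}. arc_dist C p q / ereal (dist p q))"

text \<open>
  The vertices of a convex polygon are the extreme points of the region it bounds; in
  particular, no vertex has a straight angle. The interior is required to be nonempty to
  exclude points and segments.
\<close>

definition convex_ngon :: "nat \<Rightarrow> complex set \<Rightarrow> bool" where
  "convex_ngon n C \<longleftrightarrow>
     (\<exists>P. polytope P \<and> interior P \<noteq> {} \<and> card {v. v extreme_point_of P} = n \<and> C = frontier P)"

definition centrally_symmetric :: "'a::real_vector set \<Rightarrow> bool" where
  "centrally_symmetric C \<longleftrightarrow> (\<exists>c. (\<lambda>x. 2 *\<^sub>R c - x) ` C = C)"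

end

theory Submission
  imports Defs
begin

text \<open>
  For the lower bound, let \<open>r\<close> be the distance from the centre to a nearest point \<open>p\<close> of \<open>C\<close>. An arc
  inside \<open>C\<close> from \<open>p\<close> to its antipode \<open>p'\<close> sweeps a half turn around the centre, hence visits \<open>n / 2\<close>
  consecutive vertices. By the triangle inequality and central symmetry its length is at least that
  of \<open>n / 2\<close> full sides. Every side lies on a line at distance at least \<open>r\<close> from the centre, so a side
  seen under the angle \<open>\<delta>\<close> has length at least \<open>2 * r * tan (\<delta> / 2)\<close>; the angles add up to \<open>\<pi>\<close>, and
  convexity of the tangent gives the length bound \<open>n * r * tan (\<pi> / n)\<close>, while \<open>|pp'| = 2 * r\<close>.

  Equality holds for the regular \<open>n\<close>-gon. With sides \<open>i\<close> and \<open>i + k\<close> fixed, the chord is bounded below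
  by a function that is affine in the arc length, so it suffices to compare at the ends, where the
  claim is Jordan's inequality \<open>sin x \<ge> 2 * x / \<pi>\<close>.
\<close>

subsection \<open>Angles and sides of a convex region around the origin\<close>

text \<open>The angle is a real number, not a class modulo \<open>2 * pi\<close>, so that turns
  along a curve can be measured by a continuous lift. The point \<open>0\<close> is at every
  angle.\<close>

definition at_angle :: "real \<Rightarrow> complex \<Rightarrow> bool" where
  "at_angle \<gamma> z \<longleftrightarrow> z = of_real (norm z) * cis \<gamma>"

definition cross :: "complex \<Rightarrow> complex \<Rightarrow> real" where
  "cross x y = Re x * Im y - Im x * Re y"

lemma at_angle_Re_Im:
  assumes "at_angle \<gamma> z"
  shows "Re z = norm z * cos \<gamma>" "Im z = norm z * sin \<gamma>"
proof -
  have "z = of_real (norm z) * cis \<gamma>" using assms by (simp add: at_angle_def)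
  then have "Re z = Re (of_real (norm z) * cis \<gamma>)" "Im z = Im (of_real (norm z) * cis \<gamma>)"
    by (rule arg_cong)+
  then show "Re z = norm z * cos \<gamma>" "Im z = norm z * sin \<gamma>" by simp_all
qed

lemma at_angleI: "z = of_real r * cis \<gamma> \<Longrightarrow> 0 \<le> r \<Longrightarrow> at_angle \<gamma> z"
  by (simp add: at_angle_def norm_mult)

lemma cross_at_angle:
  assumes "at_angle \<alpha> x" "at_angle \<beta> y"
  shows "cross x y = norm x * norm y * sin (\<beta> - \<alpha>)"
  using at_angle_Re_Im[OF assms(1)] at_angle_Re_Im[OF assms(2)]
  by (simp add: cross_def sin_diff algebra_simps)

lemma inner_at_angle:
  assumes "at_angle \<alpha> x" "at_angle \<beta> y"
  shows "x \<bullet> y = norm x * norm y * cos (\<beta> - \<alpha>)"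
  using at_angle_Re_Im[OF assms(1)] at_angle_Re_Im[OF assms(2)]
  by (simp add: inner_complex_def cos_diff algebra_simps)

lemma at_angle_exists:
  obtains \<gamma> where "a \<le> \<gamma>" "\<gamma> < a + 2 * pi" "at_angle \<gamma> z"
proof -
  let ?\<theta> = "Arg2pi (z * cis (- a))"
  have "is_Arg (z * cis (- a)) ?\<theta>" and *: "0 \<le> ?\<theta>" "?\<theta> < 2 * pi"
    using Arg2pi by blast+
  then have "z * cis (- a) = of_real (norm z) * cis ?\<theta>"
    by (simp add: is_Arg_def norm_mult cis_conv_exp)
  then have "z * cis (- a) * cis a = of_real (norm z) * cis ?\<theta> * cis a" by simp
  then have "z = of_real (norm z) * cis (a + ?\<theta>)"
    by (simp add: mult.assoc cis_mult add.commute)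
  with * show thesis by (intro that[of "a + ?\<theta>"]) (auto simp: at_angle_def)
qed

lemma at_angle_add_pi [simp]: "at_angle (\<gamma> + pi) (- z) \<longleftrightarrow> at_angle \<gamma> z"
  by (simp add: at_angle_def flip: cis_mult)

lemma at_angle_diff_pi [simp]: "at_angle (\<gamma> - pi) (- z) \<longleftrightarrow> at_angle \<gamma> z"
  using at_angle_add_pi[of "\<gamma> - pi" "-z"] by simp

lemma at_angle_unique:
  assumes "at_angle \<alpha> z" "at_angle \<beta> z" "z \<noteq> 0" "\<bar>\<beta> - \<alpha>\<bar> < 2 * pi"
  shows "\<alpha> = \<beta>"
proof -
  have "of_real (norm z) * cis \<alpha> = of_real (norm z) * cis \<beta>"
    using assms(1,2) unfolding at_angle_def by metis
  then have "exp (\<i> * of_real \<alpha>) = exp (\<i> * of_real \<beta>)"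
    using assms(3) by (simp add: cis_conv_exp)
  then have "\<i> * of_real \<alpha> = \<i> * of_real \<beta>"
    by (rule exp_complex_eqI[rotated]) (use assms(4) in auto)
  then show ?thesis by simp
qed

lemma cross_eq_inner: "cross x y = (\<i> * x) \<bullet> y"
  by (simp add: cross_def inner_complex_def algebra_simps)

text \<open>When the cross products on the right are nonnegative and the one on the left is
  positive, this places \<open>w\<close> in the cone spanned by \<open>x\<close> and
  \<open>z\<close>, in the form that \<open>extreme_inner_eq\<close> takes.\<close>

lemma cramer: "cross x z *\<^sub>R w = cross w z *\<^sub>R x + cross x w *\<^sub>R z"
  by (simp add: complex_eq_iff cross_def algebra_simps)

text \<open>Twice the area of the triangle \<open>0\<close>, \<open>v\<close>, \<open>w\<close> is
  \<open>cross v w\<close>. The law of cosines and \<open>0 \<le> (norm v - norm w)\<^sup>2\<close>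
  bound it above by \<open>D\<^sup>2 / (2 * tan (\<delta> / 2))\<close>; its height over the base
  \<open>D\<close> is \<open>s / norm u \<ge> r\<close>, so it is at least \<open>r * D\<close>.
  Comparing and cancelling \<open>D\<close> gives the claim.\<close>

lemma two_tan_half_le_chord:
  fixes u v w :: complex
  assumes "at_angle \<beta> v" "at_angle \<beta>' w" "\<beta> < \<beta>'" "\<beta>' < \<beta> + pi"
    and "u \<noteq> 0" "0 < s" "u \<bullet> v = s" "u \<bullet> w = s" "0 \<le> r" "r * norm u \<le> s"
  shows "2 * r * tan ((\<beta>' - \<beta>) / 2) \<le> dist v w"
proof -
  define \<delta> where "\<delta> = \<beta>' - \<beta>"
  define D where "D = dist v w"
  have \<delta>: "0 < \<delta>" "\<delta> < pi" using assms by (auto simp: \<delta>_def)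
  have nz: "v \<noteq> 0" "w \<noteq> 0" using assms by auto
  have sin: "sin \<delta> > 0" using \<delta> by (simp add: sin_gt_zero)
  have cr: "cross v w = norm v * norm w * sin \<delta>"
    using cross_at_angle[OF assms(1,2)] by (simp add: \<delta>_def)
  have pos: "cross v w > 0" using nz sin by (simp add: cr)
  have D2: "D\<^sup>2 = (norm v)\<^sup>2 + (norm w)\<^sup>2 - 2 * (norm v * norm w * cos \<delta>)"
    using inner_at_angle[OF assms(1,2)]
    by (simp add: D_def dist_norm power2_norm_eq_inner inner_diff inner_commute \<delta>_def)
  have "0 \<le> (norm v - norm w)\<^sup>2" by simp
  then have "2 * (norm v * norm w) * (1 - cos \<delta>) \<le> D\<^sup>2"
    unfolding D2 by (simp add: power2_eq_square algebra_simps)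
  moreover have "1 - cos \<delta> = sin \<delta> * tan (\<delta> / 2)"
  proof -
    have c: "cos (\<delta> / 2) > 0" using \<delta> by (intro cos_gt_zero_pi) auto
    have "cos \<delta> = 1 - 2 * (sin (\<delta> / 2))\<^sup>2" "sin \<delta> = 2 * sin (\<delta> / 2) * cos (\<delta> / 2)"
      using cos_double_sin[of "\<delta> / 2"] sin_double[of "\<delta> / 2"] by auto
    then show ?thesis using c by (simp add: tan_def power2_eq_square)
  qed
  ultimately have 1: "2 * cross v w * tan (\<delta> / 2) \<le> D\<^sup>2"
    by (simp add: cr mult.assoc)
  have uw: "u \<bullet> (w - v) = 0" using assms by (simp add: inner_diff)
  \<comment> \<open>Lagrange's identity: as \<open>u\<close> is orthogonal to \<open>w - v\<close>,
    the cross product is \<open>norm u * D\<close> up to sign. The sign is settled below by the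
    orientation of \<open>v\<close> and \<open>w\<close>.\<close>
  have "(cross u (w - v))\<^sup>2 + (u \<bullet> (w - v))\<^sup>2 = (norm u)\<^sup>2 * (norm (w - v))\<^sup>2"
    unfolding cmod_power2 by (simp add: cross_def inner_complex_def power2_eq_square algebra_simps)
  then have sq: "(cross u (w - v))\<^sup>2 = (norm u * D)\<^sup>2"
    using uw by (simp add: D_def dist_norm norm_minus_commute power_mult_distrib)
  have "(norm u)\<^sup>2 * cross v w = (u \<bullet> v) * cross u (w - v) - (u \<bullet> (w - v)) * cross u v"
    unfolding cmod_power2 by (simp add: cross_def inner_complex_def power2_eq_square algebra_simps)
  then have id: "(norm u)\<^sup>2 * cross v w = s * cross u (w - v)" using uw assms by simp
  moreover have "(norm u)\<^sup>2 * cross v w > 0" using pos assms by simp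
  ultimately have "cross u (w - v) > 0" using assms by (simp add: zero_less_mult_iff)
  then have "cross u (w - v) = norm u * D"
    using sq by (simp add: D_def power2_eq_iff_nonneg)
  then have "norm u * (norm u * cross v w) = norm u * (s * D)"
    using id by (simp add: power2_eq_square mult.assoc mult.left_commute)
  then have e: "norm u * cross v w = s * D" using assms by simp
  have D0: "D > 0" using pos by (auto simp: D_def cross_def)
  have "r * norm u * D \<le> s * D" using assms D0 by simp
  then have "norm u * (r * D) \<le> norm u * cross v w" using e by (simp add: algebra_simps)
  then have rD: "r * D \<le> cross v w" using assms by simp
  have "tan (\<delta> / 2) > 0" using \<delta> by (intro tan_gt_zero) auto
  then have "r * D * (2 * tan (\<delta> / 2)) \<le> cross v w * (2 * tan (\<delta> / 2))"
    using rD by (intro mult_right_mono) auto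
  then have "D * (2 * r * tan (\<delta> / 2)) \<le> D * D"
    using 1 by (simp add: power2_eq_square algebra_simps)
  then show ?thesis using D0 by (simp add: D_def \<delta>_def)
qed

lemma interior_scaleR:
  fixes P :: "'a::euclidean_space set"
  assumes "convex P" "0 \<in> interior P" "x \<in> P" "0 \<le> l" "l < 1"
  shows "l *\<^sub>R x \<in> interior P"
  using mem_interior_convex_shrink[OF assms(1-3), of "1 - l"] assms(4,5)
  by (simp add: algebra_simps)

text \<open>Of two frontier points on one ray the nearer would be a proper shrinking of the other
  towards the interior point \<open>0\<close>, hence interior.\<close>

lemma frontier_radial_unique:
  assumes "convex P" "closed P" "0 \<in> interior P" "x \<in> frontier P" "y \<in> frontier P"
    and "at_angle \<gamma> x" "at_angle \<gamma> y"
  shows "x = y"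
proof -
  have "norm x = norm y" if "x \<in> frontier P" "y \<in> frontier P" "at_angle \<gamma> x" "at_angle \<gamma> y" 
    "norm x \<le> norm y" for x y
  proof (rule ccontr)
    assume "norm x \<noteq> norm y"
    with that have l: "norm x < norm y" by simp
    then have "x = (norm x / norm y) *\<^sub>R y"
      using that(3,4) unfolding at_angle_def
      by (metis (no_types, lifting) divide_eq_eq_numeral1(1) mult.assoc nonzero_eq_divide_eq
          norm_ge_zero not_less of_real_mult scaleR_conv_of_real)
    moreover have "y \<in> P" using assms(2) that(2) by (auto simp: frontier_def)
    ultimately have "x \<in> interior P"
      using interior_scaleR[OF assms(1,3), of y "norm x / norm y"] l
      by (metis divide_less_eq_1_pos divide_nonneg_nonneg norm_ge_zero not_less order_less_le_trans order.strict_trans1)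
    then show False using that(1) by (simp add: frontier_def)
  qed
  then have "norm x = norm y" using assms by (metis nle_le)
  then show ?thesis using assms(6,7) unfolding at_angle_def by metis
qed

text \<open>The point \<open>w\<close> is a multiple \<open>?l\<close> of a point \<open>y\<close>
  of the segment from \<open>x\<close> to \<open>z\<close>, which lies on the supporting line. The
  half-plane forces \<open>?l \<le> 1\<close>, and \<open>?l < 1\<close> would make the extreme
  point \<open>w\<close> interior.\<close>

lemma extreme_inner_eq:
  fixes P :: "'a::euclidean_space set"
  assumes P: "convex P" "0 \<in> interior P" and le: "\<And>y. y \<in> P \<Longrightarrow> u \<bullet> y \<le> s"
    and "0 < s" "x \<in> P" "z \<in> P" "u \<bullet> x = s" "u \<bullet> z = s"
    and w: "w extreme_point_of P" "c *\<^sub>R w = a *\<^sub>R x + b *\<^sub>R z" "0 < c" "0 \<le> a" "0 \<le> b"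
  shows "u \<bullet> w = s"
proof (cases "a + b = 0")
  case True
  then have "a = 0" "b = 0" using w by auto
  then have "w = 0" using w by simp
  then show ?thesis using extreme_point_not_in_interior[OF w(1)] P(2) by simp
next
  case False
  then have ab: "a + b > 0" using w by auto
  let ?l = "(a + b) / c"
  define y where "y = (a / (a + b)) *\<^sub>R x + (b / (a + b)) *\<^sub>R z"
  have "y \<in> P" unfolding y_def
    using ab w assms by (intro convexD) (auto simp flip: add_divide_distrib)
  have "w = (1 / c) *\<^sub>R (c *\<^sub>R w)" using \<open>0 < c\<close> by simp
  also have "\<dots> = ?l *\<^sub>R y"
    unfolding w(2) y_def using ab w by (simp add: scaleR_add_right)
  finally have wy: "w = ?l *\<^sub>R y" .
  have uy: "u \<bullet> y = s"
    unfolding y_def using assms ab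
    by (simp add: inner_add_right flip: add_divide_distrib distrib_right)
  have "w \<in> P" using w(1) by (simp add: extreme_point_of_def)
  then have "?l * s \<le> s" using le[of w] wy uy by simp
  then have "?l \<le> 1" using \<open>0 < s\<close> mult_le_cancel_right2[of ?l s] by linarith
  moreover have "\<not> ?l < 1"
    using interior_scaleR[OF P \<open>y \<in> P\<close>, of ?l] extreme_point_not_in_interior[OF w(1)] ab w
    unfolding wy by auto
  ultimately have "?l = 1" by simp
  then show ?thesis using wy uy by simp
qed

text \<open>The line is a supporting line at the frontier point \<open>x\<close> in the bisecting
  direction \<open>\<phi>\<close>. The face \<open>F\<close> that it cuts out has extreme points on
  both sides of the ray through \<open>x\<close>, and the gap keeps them from lying strictly between
  \<open>v\<close> and \<open>w\<close>. So \<open>v\<close> and \<open>w\<close> each lie in a cone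
  spanned by \<open>x\<close> and such a point, and \<open>extreme_inner_eq\<close> applies.\<close>

lemma consecutive_extreme_points_supported:
  fixes P :: "complex set"
  assumes P: "convex P" "compact P" "0 \<in> interior P"
    and v: "v extreme_point_of P" "at_angle \<beta> v"
    and w: "w extreme_point_of P" "at_angle \<beta>' w"
    and \<beta>: "\<beta> < \<beta>'" "\<beta>' \<le> \<beta> + pi"
    and gap: "\<And>z \<gamma>. z extreme_point_of P \<Longrightarrow> at_angle \<gamma> z \<Longrightarrow> \<beta> < \<gamma> \<Longrightarrow> \<gamma> < \<beta>' \<Longrightarrow> False"
  obtains u s where "u \<noteq> 0" "0 < s" "\<And>y. y \<in> P \<Longrightarrow> u \<bullet> y \<le> s" "u \<bullet> v = s" "u \<bullet> w = s"
proof -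
  define \<phi> where "\<phi> = (\<beta> + \<beta>') / 2"
  obtain d where d: "0 < d" "0 + d *\<^sub>R cis \<phi> \<in> frontier P"
    using ray_to_frontier[OF compact_imp_bounded[OF P(2)] P(3), of "cis \<phi>"] by auto
  define x where "x = d *\<^sub>R cis \<phi>"
  have x: "x \<in> frontier P" "at_angle \<phi> x" "x \<noteq> 0"
    using d by (auto simp: x_def at_angle_def norm_mult scaleR_conv_of_real)
  have xP: "x \<in> P" using x P(2) by (auto simp: frontier_def compact_imp_closed)
  have xr: "x \<notin> rel_interior P" 
    using x(1) P(3) by (metis DiffD2 empty_iff frontier_def interior_rel_interior_gen rel_interior_interior
      affine_hull_nonempty_interior)
  obtain a where a: "a \<noteq> 0" "\<And>y. y \<in> P \<Longrightarrow> a \<bullet> x \<le> a \<bullet> y"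
    "\<And>y. y \<in> rel_interior P \<Longrightarrow> a \<bullet> x < a \<bullet> y"
    using supporting_hyperplane_rel_boundary[OF P(1) xP xr] by metis
  define u where "u = - a"
  define s where "s = u \<bullet> x"
  have s: "0 < s"
    using a(3)[of 0] P(3) interior_subset_rel_interior by (auto simp: s_def u_def)
  have le: "u \<bullet> y \<le> s" if "y \<in> P" for y using a(2)[OF that] by (simp add: s_def u_def)
  define F where "F = P \<inter> {y. u \<bullet> y = s}"
  have face: "F face_of P"
    unfolding F_def by (rule face_of_Int_supporting_hyperplane_le[OF P(1) le])
  have "F = convex hull {z. z extreme_point_of F}"
    using Krein_Milman_Minkowski face face_of_imp_compact face_of_imp_convex P by blast
  moreover have "x \<in> F" using xP by (simp add: F_def s_def)
  ultimately have hull: "x \<in> convex hull {z. z extreme_point_of F}" by simp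
  have ext: "z extreme_point_of P \<and> u \<bullet> z = s \<and> z \<in> P" if "z extreme_point_of F" for z
    using that extreme_point_of_face[OF face] by (auto simp: F_def)
  \<comment> \<open>An extreme point of \<open>F\<close> parallel to \<open>x\<close> would equal
    \<open>x\<close>, since both satisfy \<open>u \<bullet> z = s\<close> with \<open>s > 0\<close>;
    then \<open>x\<close> would be an extreme point inside the gap.\<close>
  have cross_nz: "cross x z \<noteq> 0" if z: "z extreme_point_of F" for z
  proof
    assume "cross x z = 0"
    have "(norm x)\<^sup>2 *\<^sub>R z = (x \<bullet> z) *\<^sub>R x + cross x z *\<^sub>R (\<i> * x)"
      unfolding cmod_power2
      by (simp add: complex_eq_iff cross_def inner_complex_def power2_eq_square algebra_simps)
    then have e: "(norm x)\<^sup>2 *\<^sub>R z = (x \<bullet> z) *\<^sub>R x" using \<open>cross x z = 0\<close> by simp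
    then have "u \<bullet> ((norm x)\<^sup>2 *\<^sub>R z) = u \<bullet> ((x \<bullet> z) *\<^sub>R x)" by simp
    then have "(norm x)\<^sup>2 * s = (x \<bullet> z) * s" using ext[OF z] by (simp add: s_def)
    then have "(norm x)\<^sup>2 = x \<bullet> z" using s by simp
    then have "(norm x)\<^sup>2 *\<^sub>R z = (norm x)\<^sup>2 *\<^sub>R x" using e by simp
    then have "z = x" using x(3) by simp
    then have "x extreme_point_of P" using ext[OF z] by simp
    moreover have "\<beta> < \<phi>" "\<phi> < \<beta>'" using \<beta> by (auto simp: \<phi>_def)
    ultimately show False using gap x(2) by blast
  qed
  \<comment> \<open>Otherwise all extreme points of \<open>F\<close>, and with them their hull,
    would lie strictly on one side of the line through \<open>0\<close> and \<open>x\<close>,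
    although the hull contains \<open>x\<close>.\<close>
  have nex: "\<exists>z. z extreme_point_of F \<and> c \<bullet> z > 0"
    if c: "c \<bullet> x = 0" "\<And>z. z extreme_point_of F \<Longrightarrow> c \<bullet> z \<noteq> 0" for c
  proof (rule ccontr)
    assume neg: "\<not> ?thesis"
    have "c \<bullet> z < 0" if "z extreme_point_of F" for z
    proof -
      have "\<not> c \<bullet> z > 0" using neg that by blast
      then show ?thesis using c(2)[OF that] by linarith
    qed
    then have "{z. z extreme_point_of F} \<subseteq> {z. c \<bullet> z < 0}" by blast
    then have "convex hull {z. z extreme_point_of F} \<subseteq> {z. c \<bullet> z < 0}"
      by (intro hull_minimal convex_halfspace_lt)
    then show False using hull c(1) by auto
  qed
  have xx: "(\<i> * x) \<bullet> x = 0" by (simp add: inner_complex_def)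
  obtain zp where zp: "zp extreme_point_of F" "cross x zp > 0"
    using nex[of "\<i> * x"] xx cross_nz by (auto simp: cross_eq_inner)
  obtain zm where zm: "zm extreme_point_of F" "cross x zm < 0"
    using nex[of "- (\<i> * x)"] xx cross_nz by (auto simp: cross_eq_inner)
  have "u \<bullet> w = s"
  proof -
    obtain \<psi> where \<psi>: "\<phi> \<le> \<psi>" "\<psi> < \<phi> + 2 * pi" "at_angle \<psi> zp" by (rule at_angle_exists)
    have "norm x * norm zp * sin (\<psi> - \<phi>) > 0" using cross_at_angle[OF x(2) \<psi>(3)] zp by simp
    then have "sin (\<psi> - \<phi>) > 0" by (metis mult_nonneg_nonneg mult_nonneg_nonpos norm_ge_zero not_less)
    then have "\<psi> \<noteq> \<phi>" "\<not> \<phi> + pi \<le> \<psi>"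
      using sin_le_zero[of "\<psi> - \<phi>"] \<psi> by (force, linarith)
    then have \<psi>\<phi>: "\<phi> < \<psi>" "\<psi> < \<phi> + pi" using \<psi> by linarith+
    have "\<beta> < \<phi>" "\<phi> < \<beta>'" using \<beta> by (auto simp: \<phi>_def)
    moreover have "\<not> \<psi> < \<beta>'"
      using gap[OF _ \<psi>(3)] ext[OF zp(1)] \<psi>\<phi>(1) \<open>\<beta> < \<phi>\<close> by (meson less_trans)
    ultimately have "\<psi> - \<beta>' \<ge> 0" "\<psi> - \<beta>' \<le> pi" "\<beta>' - \<phi> \<ge> 0" "\<beta>' - \<phi> \<le> pi"
      using \<psi>\<phi> by linarith+
    then have "sin (\<psi> - \<beta>') \<ge> 0" "sin (\<beta>' - \<phi>) \<ge> 0"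
      by (auto intro: sin_ge_zero)
    then have "cross w zp \<ge> 0" "cross x w \<ge> 0"
      using cross_at_angle[OF w(2) \<psi>(3)] cross_at_angle[OF x(2) w(2)] by auto
    then show ?thesis
      by (intro extreme_inner_eq[OF P(1,3) le s xP _ s_def[symmetric] _ w(1) cramer zp(2)])
        (use ext[OF zp(1)] in blast)+
  qed
  moreover have "u \<bullet> v = s"
  proof -
    \<comment> \<open>The windows of \<open>at_angle_exists\<close> are closed on the left.
      Conjugation turns this one into a window for \<open>zm\<close> that is closed at its right end
      \<open>\<phi>\<close>.\<close>
    obtain \<psi>' where \<psi>': "- \<phi> \<le> \<psi>'" "\<psi>' < - \<phi> + 2 * pi" "at_angle \<psi>' (cnj zm)"
      by (rule at_angle_exists)
    define \<psi> where "\<psi> = - \<psi>'"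
    have \<psi>: "\<psi> \<le> \<phi>" "\<phi> - 2 * pi < \<psi>" "at_angle \<psi> zm"
    proof -
      have "cnj (cnj zm) = cnj (of_real (norm (cnj zm)) * cis \<psi>')"
        using \<psi>'(3) by (simp only: at_angle_def)
      then show "at_angle \<psi> zm" by (simp add: at_angle_def \<psi>_def cis_cnj)
    qed (use \<psi>' in \<open>auto simp: \<psi>_def\<close>)
    have "norm zm * norm x * sin (\<phi> - \<psi>) > 0"
      using cross_at_angle[OF \<psi>(3) x(2)] zm by (simp add: cross_def algebra_simps)
    then have "sin (\<phi> - \<psi>) > 0" by (metis mult_nonneg_nonneg mult_nonneg_nonpos norm_ge_zero not_less)
    then have "\<psi> \<noteq> \<phi>" "\<not> \<psi> + pi \<le> \<phi>"
      using sin_le_zero[of "\<phi> - \<psi>"] \<psi> by (force, linarith)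
    then have \<psi>\<phi>: "\<psi> < \<phi>" "\<phi> < \<psi> + pi" using \<psi> by linarith+
    have "\<beta> < \<phi>" "\<phi> < \<beta>'" using \<beta> by (auto simp: \<phi>_def)
    moreover have "\<not> \<beta> < \<psi>"
      using gap[OF _ \<psi>(3)] ext[OF zm(1)] \<psi>\<phi>(1) \<open>\<phi> < \<beta>'\<close> by (meson less_trans)
    ultimately have "\<beta> - \<psi> \<ge> 0" "\<beta> - \<psi> \<le> pi" "\<phi> - \<beta> \<ge> 0" "\<phi> - \<beta> \<le> pi"
      using \<psi>\<phi> by linarith+
    then have "sin (\<beta> - \<psi>) \<ge> 0" "sin (\<phi> - \<beta>) \<ge> 0"
      by (auto intro: sin_ge_zero)
    then have nn: "cross zm v \<ge> 0" "cross v x \<ge> 0"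
      using cross_at_angle[OF \<psi>(3) v(2)] cross_at_angle[OF v(2) x(2)] by auto
    have "cross zm x > 0" using zm by (simp add: cross_def algebra_simps)
    show ?thesis
      by (rule extreme_inner_eq[OF P(1,3) le s _ xP _ s_def[symmetric] v(1) cramer \<open>cross zm x > 0\<close> nn(2) nn(1)])
        (use ext[OF zm(1)] in blast)+
  qed
  moreover have "u \<noteq> 0" using a(1) by (simp add: u_def)
  ultimately show thesis using that s le by blast
qed

subsection \<open>Curves joining antipodal points\<close>

lemma convex_on_tan: "convex_on {0..<pi/2} (tan :: real \<Rightarrow> real)"
proof (rule convex_on_realI)
  fix x :: real assume x: "x \<in> {0..<pi/2}"
  then have "cos x \<noteq> 0" using cos_gt_zero_pi[of x] by auto
  then show "(tan has_real_derivative 1 + (tan x)\<^sup>2) (at x)"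
    by (auto intro!: derivative_eq_intros simp: tan_sec power_inverse)
next
  fix x y :: real assume xy: "x \<in> {0..<pi/2}" "y \<in> {0..<pi/2}" "x \<le> y"
  have "0 \<le> tan x" using xy tan_gt_zero[of x] by (cases "x = 0") auto
  moreover have "tan x \<le> tan y" using xy by (intro tan_mono_le) auto
  ultimately show "1 + (tan x)\<^sup>2 \<le> 1 + (tan y)\<^sup>2" by (simp add: power_mono)
qed auto

text \<open>Jensen's inequality with equal weights.\<close>

lemma card_tan_le_sum_tan:
  assumes "0 < h" "\<And>i. i < h \<Longrightarrow> 0 \<le> d i \<and> d i < pi / 2"
  shows "real h * tan ((\<Sum>i<h. d i) / real h) \<le> (\<Sum>i<h. tan (d i))"
proof -
  have "tan (\<Sum>i<h. (1 / real h) *\<^sub>R d i) \<le> (\<Sum>i<h. (1 / real h) * tan (d i))"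
    by (rule convex_on_sum[OF _ _ convex_on_tan]) (use assms in auto)
  then have "tan ((\<Sum>i<h. d i) / real h) \<le> (\<Sum>i<h. tan (d i)) / real h"
    by (simp flip: sum_divide_distrib)
  then show ?thesis using assms(1) by (simp add: field_simps)
qed

text \<open>The times are chosen one after another: the next value lies between
  \<open>\<theta> (t m)\<close> and \<open>\<theta> 1\<close>, so the intermediate value theorem on
  \<open>{t m..1}\<close> finds a later time for it.\<close>

lemma IVT_mono_times:
  fixes \<theta> :: "real \<Rightarrow> real" and \<alpha> :: "nat \<Rightarrow> real"
  assumes "continuous_on {0..1} \<theta>" "mono_on {..m} \<alpha>" "\<alpha> 0 = \<theta> 0" "\<alpha> m \<le> \<theta> 1"
  shows "\<exists>t. mono_on {..m} t \<and> t ` {..m} \<subseteq> {0..1} \<and> (\<forall>i\<le>m. \<theta> (t i) = \<alpha> i)"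
  using assms(2,4)
proof (induction m)
  case 0
  then show ?case using assms(3) by (intro exI[of _ "\<lambda>_. 0"]) (auto simp: mono_on_def)
next
  case (Suc m)
  have "mono_on {..m} \<alpha>" using Suc.prems by (auto simp: mono_on_def)
  moreover have le: "\<alpha> m \<le> \<alpha> (Suc m)" using Suc.prems by (auto simp: mono_on_def)
  ultimately obtain t where t: "mono_on {..m} t" "t ` {..m} \<subseteq> {0..1}" "\<forall>i\<le>m. \<theta> (t i) = \<alpha> i"
    using Suc by force
  have tm: "t m \<in> {0..1}" using t(2) by auto
  have "continuous_on {t m..1} \<theta>" using tm by (intro continuous_on_subset[OF assms(1)]) auto
  then obtain x where x: "t m \<le> x" "x \<le> 1" "\<theta> x = \<alpha> (Suc m)"
    using IVT'[of \<theta> "t m" "\<alpha> (Suc m)" 1] t(3) le Suc.prems tm by auto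
  have "mono_on {..Suc m} (t(Suc m := x))"
    unfolding mono_on_def
  proof (intro allI impI)
    fix i j assume ij: "i \<in> {..Suc m} \<and> j \<in> {..Suc m} \<and> i \<le> j"
    have "t i \<le> x" if "i \<le> m"
      using t(1) that x(1) by (auto simp: mono_on_def intro: order_trans[of _ "t m"])
    then show "(t(Suc m := x)) i \<le> (t(Suc m := x)) j"
      using ij t(1) by (cases "j = Suc m"; cases "i = Suc m") (auto simp: mono_on_def)
  qed
  moreover have "(t(Suc m := x)) ` {..Suc m} \<subseteq> {0..1}"
    using t(2) x order_trans[of 0 "t m" x] tm by (auto simp: image_subset_iff)
  moreover have "\<forall>i\<le>Suc m. \<theta> ((t(Suc m := x)) i) = \<alpha> i"
    using t(3) x(3) by (auto simp: le_Suc_eq)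
  ultimately show ?case by blast
qed

text \<open>With angles measured from \<open>a\<close>, the set splits into the part
  \<open>W\<close> in the first half turn and its antipodes. Sorting the angles of \<open>W\<close>
  gives the enumeration, which closes up at the antipode of its first member.\<close>

lemma half_turn_enumeration:
  fixes V :: "complex set"
  assumes V: "finite V" "V \<noteq> {}" "0 \<notin> V" "\<And>v. v \<in> V \<Longrightarrow> - v \<in> V"
    and uniq: "\<And>v w \<gamma>. v \<in> V \<Longrightarrow> w \<in> V \<Longrightarrow> at_angle \<gamma> v \<Longrightarrow> at_angle \<gamma> w \<Longrightarrow> v = w"
  obtains h :: nat and \<beta> vs where "card V = 2 * h" "0 < h"
    "\<And>i. i < h \<Longrightarrow> \<beta> i < \<beta> (Suc i)" "a \<le> \<beta> 0" "\<And>i. i < h \<Longrightarrow> \<beta> i < a + pi"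
    "\<beta> h = \<beta> 0 + pi" "vs h = - vs 0"
    "\<And>i. i \<le> h \<Longrightarrow> vs i \<in> V" "\<And>i. i \<le> h \<Longrightarrow> at_angle (\<beta> i) (vs i)"
    "\<And>i \<gamma> v. i < h \<Longrightarrow> v \<in> V \<Longrightarrow> at_angle \<gamma> v \<Longrightarrow> \<beta> i < \<gamma> \<Longrightarrow> \<gamma> < \<beta> (Suc i) \<Longrightarrow> False"
proof -
  have "\<exists>\<gamma>. a \<le> \<gamma> \<and> \<gamma> < a + 2 * pi \<and> at_angle \<gamma> v" for v
    by (metis at_angle_exists)
  then obtain ang where ang: "\<And>v. a \<le> ang v" "\<And>v. ang v < a + 2 * pi" "\<And>v. at_angle (ang v) v"
    by metis
  have ang_eq: "ang v = \<gamma>" if "v \<in> V" "at_angle \<gamma> v" "a \<le> \<gamma>" "\<gamma> < a + 2 * pi" for v \<gamma>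
    using at_angle_unique[OF ang(3) that(2)] ang(1,2)[of v] that V(3) by (auto simp: abs_less_iff)
  define W where "W = {v \<in> V. ang v < a + pi}"
  have ang_minus: "ang (- v) = (if ang v < a + pi then ang v + pi else ang v - pi)" if "v \<in> V" for v
    using ang(1,2)[of v] ang(3)[of v] V(4)[OF that] by (auto intro!: ang_eq)
  have "V = W \<union> uminus ` W"
  proof (intro equalityI subsetI)
    fix v assume v: "v \<in> V"
    show "v \<in> W \<union> uminus ` W"
    proof (cases "ang v < a + pi")
      case False
      then have "- v \<in> W" using ang_minus[OF v] V(4)[OF v] ang(2)[of v] by (simp add: W_def)
      then show ?thesis by (metis UnI2 image_eqI minus_minus)
    qed (use v in \<open>simp add: W_def\<close>)
  qed (use V(4) in \<open>auto simp: W_def\<close>)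
  moreover have "W \<inter> uminus ` W = {}"
  proof -
    have "- w \<notin> W" if "w \<in> W" for w
      using ang_minus[of w] ang(1)[of w] that by (simp add: W_def)
    then show ?thesis by blast
  qed
  moreover have fW: "finite W" using V(1) by (simp add: W_def)
  ultimately have card: "card V = 2 * card W"
    by (metis card_Un_disjoint card_image finite_imageI inj_uminus mult_2)
  define S where "S = ang ` W"
  have inj: "inj_on ang W"
    by (rule inj_onI) (metis (lifting) W_def ang(3) mem_Collect_eq uniq)
  have fS: "finite S" and cS: "card S = card W" using fW inj by (auto simp: S_def card_image)
  define h where "h = card W"
  have h: "0 < h" using card V h_def by (metis card_gt_0_iff gr0I mult_0_right)
  define xs where "xs = sorted_list_of_set S"
  have xs: "length xs = h" "set xs = S" "sorted_wrt (<) xs"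
    using fS cS by (auto simp: xs_def h_def)
  have xsS: "xs ! i \<in> S" if "i < h" for i using xs that nth_mem by metis
  \<comment> \<open>Index \<open>h\<close> restarts the list half a turn later, matching
    \<open>vs h = - vs 0\<close>.\<close>
  define \<beta> where "\<beta> i = (if i < h then xs ! i else xs ! 0 + pi)" for i
  have "\<exists>w. w \<in> W \<and> ang w = xs ! i" if "i < h" for i using xsS[OF that] by (auto simp: S_def)
  then obtain ws where ws: "\<And>i. i < h \<Longrightarrow> ws i \<in> W" "\<And>i. i < h \<Longrightarrow> ang (ws i) = xs ! i" by metis
  define vs where "vs i = (if i < h then ws i else - ws 0)" for i
  have rng: "a \<le> xs ! i" "xs ! i < a + pi" if "i < h" for i
    using ws[OF that] ang(1)[of "ws i"] by (auto simp: W_def)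
  show thesis
  proof (rule that[of h \<beta> vs])
    show "card V = 2 * h" "0 < h" using card h by (auto simp: h_def)
    show "\<beta> i < \<beta> (Suc i)" if "i < h" for i
    proof (cases "Suc i < h")
      case True
      then show ?thesis using sorted_wrt_nth_less[OF xs(3), of i "Suc i"] xs(1) by (simp add: \<beta>_def)
    next
      case False
      then show ?thesis using rng[OF that] rng[of 0] h that by (simp add: \<beta>_def)
    qed
    show "a \<le> \<beta> 0" using rng[of 0] h by (simp add: \<beta>_def)
    show "\<beta> i < a + pi" if "i < h" for i using rng[OF that] that by (simp add: \<beta>_def)
    show "\<beta> h = \<beta> 0 + pi" "vs h = - vs 0" using h by (auto simp: \<beta>_def vs_def)
    show "vs i \<in> V" if "i \<le> h" for i
      using ws(1)[of i] ws(1)[of 0] h V(4) by (auto simp: vs_def W_def)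
    show "at_angle (\<beta> i) (vs i)" if "i \<le> h" for i
      using ang(3)[of "ws i"] ang(3)[of "ws 0"] ws(2) h by (auto simp: vs_def \<beta>_def)
    show False if i: "i < h" "v \<in> V" "at_angle \<gamma> v" "\<beta> i < \<gamma>" "\<gamma> < \<beta> (Suc i)" for i \<gamma> v
    proof -
      have \<beta>i: "\<beta> i = xs ! i" "a \<le> xs ! i" using i rng by (auto simp: \<beta>_def)
      have mem: "\<exists>j<h. x = xs ! j" if "w \<in> V" "at_angle x w" "a \<le> x" "x < a + pi" for w x
      proof -
        have "ang w = x" using ang_eq that by simp
        then have "x \<in> set xs" using that xs(2) by (auto simp: S_def W_def)
        then show ?thesis using xs(1) by (metis in_set_conv_nth)
      qed
      have mono: "xs ! j \<le> xs ! k" if "j \<le> k" "k < h" for j k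
        using sorted_wrt_nth_less[OF xs(3), of j k] xs(1) that by (cases "j = k") auto
      show False
      proof (cases "\<gamma> < a + pi")
        case True
        then obtain j where j: "j < h" "\<gamma> = xs ! j" using mem[OF i(2,3)] i \<beta>i by auto
        then have "\<not> j \<le> i" using mono[of j i] i \<beta>i by auto
        then have "i < j" by simp
        then have "Suc i < h" "xs ! Suc i \<le> xs ! j" using j mono by auto
        then show False using i j by (simp add: \<beta>_def)
      next
        case False
        \<comment> \<open>Only the last gap reaches beyond the first half turn. There
          \<open>- v\<close> has the angle \<open>\<gamma> - pi\<close>, which would be a list entry
          below the smallest one.\<close>
        have "\<not> Suc i < h" using False i rng[of "Suc i"] by (auto simp: \<beta>_def)
        then have "\<gamma> - pi < xs ! 0" using i by (simp add: \<beta>_def)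
        moreover obtain j where "j < h" "\<gamma> - pi = xs ! j"
          using mem[of "- v" "\<gamma> - pi"] i V(4) False rng[of 0] h calculation by auto
        ultimately show False using mono[of 0 j] by auto
      qed
    qed
  qed
qed

lemma curve_length_ge:
  assumes "mono_on {..k} t" "t ` {..k} \<subseteq> {0..1}"
  shows "ereal (\<Sum>i<k. dist (g (t i)) (g (t (Suc i)))) \<le> curve_length g"
  unfolding curve_length_def by (rule SUP_upper2[of "(k, t)"]) (use assms in auto)

lemma curve_length_reversepath_le: "curve_length (reversepath g) \<le> curve_length g"
proof -
  have "ereal (\<Sum>i<k. dist (reversepath g (t i)) (reversepath g (t (Suc i)))) \<le> curve_length g"
    if t: "mono_on {..k} t" "t ` {..k} \<subseteq> {0..1}" for k t
  proof -
    \<comment> \<open>The same partition, mirrored in \<open>{0..1}\<close> and read backwards so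
      that it increases again.\<close>
    define t' where "t' i = 1 - t (k - i)" for i
    have "(\<Sum>i<k. dist (reversepath g (t i)) (reversepath g (t (Suc i))))
        = (\<Sum>i<k. dist (reversepath g (t (k - Suc i))) (reversepath g (t (Suc (k - Suc i)))))"
      by (rule sum.nat_diff_reindex[symmetric])
    also have "\<dots> = (\<Sum>i<k. dist (g (t' i)) (g (t' (Suc i))))"
      by (rule sum.cong) (auto simp: t'_def reversepath_def dist_commute Suc_diff_Suc)
    also have "ereal \<dots> \<le> curve_length g"
      by (rule curve_length_ge) (use t in \<open>auto simp: t'_def mono_on_def image_subset_iff\<close>)
    finally show ?thesis .
  qed
  then show ?thesis unfolding curve_length_def[of "reversepath g"] by (intro SUP_least) auto
qed

lemma extreme_point_uminus:
  assumes "\<And>x. x \<in> P \<Longrightarrow> - x \<in> P" "v extreme_point_of P"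
  shows "- v extreme_point_of P"
proof -
  have "v \<in> open_segment (- a) (- b)" if "- v \<in> open_segment a b" for a b
    using that by (auto simp: in_segment algebra_simps)
  then show ?thesis using assms unfolding extreme_point_of_def by (metis minus_minus)
qed

lemma interior_uminus:
  fixes P :: "'a::euclidean_space set"
  assumes "\<And>x. x \<in> P \<Longrightarrow> - x \<in> P" "v \<in> interior P"
  shows "- v \<in> interior P"
proof -
  have "x \<in> uminus ` P" if "x \<in> P" for x
    using assms(1)[OF that] by (intro image_eqI[of _ _ "- x"]) auto
  then have "uminus ` P = P" using assms(1) by auto
  then have "interior P = uminus ` interior P" by (metis interior_negations)
  then show ?thesis using assms(2) by blast
qed

lemma frontier_uminus:
  fixes P :: "'a::euclidean_space set"
  assumes "closed P" "\<And>x. x \<in> P \<Longrightarrow> - x \<in> P" "v \<in> frontier P"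
  shows "- v \<in> frontier P"
  using assms(1,3) assms(2)[of v] interior_uminus[OF assms(2), of "- v"]
  by (auto simp: frontier_def)

text \<open>Extreme points lie on the frontier, so radial uniqueness allows the enumeration of a
  half turn. The equation \<open>card V = 2 * h\<close> is also the source of the evenness of
  \<open>n\<close>.\<close>

lemma extreme_points_half_turn:
  fixes P :: "complex set"
  assumes P: "convex P" "compact P" "0 \<in> interior P" "\<And>x. x \<in> P \<Longrightarrow> - x \<in> P"
    and V: "V = {v. v extreme_point_of P}" "finite V"
  obtains h :: nat and \<beta> vs where "card V = 2 * h" "0 < h"
    "\<And>i. i < h \<Longrightarrow> \<beta> i < \<beta> (Suc i)" "a \<le> \<beta> 0" "\<And>i. i < h \<Longrightarrow> \<beta> i < a + pi"
    "\<beta> h = \<beta> 0 + pi" "vs h = - vs 0"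
    "\<And>i. i \<le> h \<Longrightarrow> vs i \<in> V" "\<And>i. i \<le> h \<Longrightarrow> at_angle (\<beta> i) (vs i)"
    "\<And>i \<gamma> v. i < h \<Longrightarrow> v \<in> V \<Longrightarrow> at_angle \<gamma> v \<Longrightarrow> \<beta> i < \<gamma> \<Longrightarrow> \<gamma> < \<beta> (Suc i) \<Longrightarrow> False"
proof -
  have cl: "closed P" using P by (simp add: compact_imp_closed)
  have "v \<in> frontier P" if "v \<in> V" for v
    using that extreme_point_not_in_interior[of v P] cl
    by (auto simp: V frontier_def extreme_point_of_def closure_closed)
  then have uniq: "v = w" if "v \<in> V" "w \<in> V" "at_angle \<gamma> v" "at_angle \<gamma> w" for v w \<gamma>
    using frontier_radial_unique[OF P(1) cl P(3)] that by blast
  have "V \<noteq> {}"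
  proof
    assume "V = {}"
    then have "P = {}" using Krein_Milman_Minkowski[OF P(2,1)] V(1) by (metis convex_hull_empty)
    then show False using P(3) by simp
  qed
  moreover have "0 \<notin> V" using P(3) extreme_point_not_in_interior by (auto simp: V)
  moreover have "- v \<in> V" if "v \<in> V" for v
    using that extreme_point_uminus[OF P(4)] by (simp add: V(1))
  ultimately show thesis
    by (rule half_turn_enumeration[OF V(2) _ _ _ uniq, where a = a]) (assumption | (rule that; assumption))+
qed

lemma half_turn_curve_length:
  fixes P :: "complex set" and r :: real
  assumes P: "convex P" "compact P" "0 \<in> interior P" "\<And>x. x \<in> P \<Longrightarrow> - x \<in> P"
    and V: "V = {v. v extreme_point_of P}" "finite V"
    and r: "0 \<le> r" "cball 0 r \<subseteq> P"
    and g: "g ` {0..1} \<subseteq> frontier P" "continuous_on {0..1} \<theta>"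
       "\<And>t. t \<in> {0..1} \<Longrightarrow> at_angle (\<theta> t) (g t)" "\<theta> 0 + pi \<le> \<theta> 1"
  shows "ereal (card V * r * tan (pi / card V)) \<le> curve_length g"
proof -
  have cl: "closed P" using P by (simp add: compact_imp_closed)
  have Vfr: "v \<in> frontier P" if "v \<in> V" for v
    using that extreme_point_not_in_interior[of v P] cl
    by (auto simp: V frontier_def extreme_point_of_def closure_closed)
  note frm = frontier_uminus[OF cl P(4)]
  note uniq = frontier_radial_unique[OF P(1) cl P(3)]
  obtain h \<beta> vs where h: "card V = 2 * h" "0 < h"
    and \<beta>: "\<And>i. i < h \<Longrightarrow> \<beta> i < \<beta> (Suc i)" "\<theta> 0 \<le> \<beta> 0" "\<And>i. i < h \<Longrightarrow> \<beta> i < \<theta> 0 + pi"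
      "\<beta> h = \<beta> 0 + pi"
    and vs: "vs h = - vs 0" "\<And>i. i \<le> h \<Longrightarrow> vs i \<in> V" "\<And>i. i \<le> h \<Longrightarrow> at_angle (\<beta> i) (vs i)"
    and gap: "\<And>i \<gamma> v. i < h \<Longrightarrow> v \<in> V \<Longrightarrow> at_angle \<gamma> v \<Longrightarrow> \<beta> i < \<gamma> \<Longrightarrow> \<gamma> < \<beta> (Suc i) \<Longrightarrow> False"
    by (rule extreme_points_half_turn[OF P V, where a = "\<theta> 0"]) (assumption | (rule that; assumption))+
  define d where "d i = (\<beta> (Suc i) - \<beta> i) / 2" for i
  have mono: "\<beta> i \<le> \<beta> j" if "i \<le> j" "j \<le> h" for i j
    using that
  proof (induction rule: dec_induct)
    case (step n)
    then show ?case using \<beta>(1)[of n] by simp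
  qed simp
  have edge: "2 * r * tan (d i) \<le> dist (vs i) (vs (Suc i)) \<and> 0 \<le> d i \<and> d i < pi / 2" if i: "i < h" for i
  proof -
    have le: "\<beta> (Suc i) \<le> \<beta> i + pi" using mono[of 0 i] mono[of "Suc i" h] i \<beta>(4) by simp
    have ext: "vs i extreme_point_of P" "vs (Suc i) extreme_point_of P" using vs(2) i by (auto simp: V)
    have at: "at_angle (\<beta> i) (vs i)" "at_angle (\<beta> (Suc i)) (vs (Suc i))" using vs(3) i by auto
    obtain u s where u: "u \<noteq> 0" "0 < s" "\<And>y. y \<in> P \<Longrightarrow> u \<bullet> y \<le> s" "u \<bullet> vs i = s" "u \<bullet> vs (Suc i) = s"
      using consecutive_extreme_points_supported[OF P(1-3) ext(1) at(1) ext(2) at(2) \<beta>(1)[OF i] le] gap[OF i]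
      by (metis V(1) mem_Collect_eq)
    \<comment> \<open>A gap of exactly \<open>pi\<close> would make the two vertices antipodal, and
      \<open>u\<close> could not take the same positive value \<open>s\<close> at both.\<close>
    have "\<beta> (Suc i) \<noteq> \<beta> i + pi"
    proof
      assume "\<beta> (Suc i) = \<beta> i + pi"
      then have "at_angle (\<beta> i) (- vs (Suc i))" using at(2) by (metis at_angle_add_pi minus_minus)
      then have "- vs (Suc i) = vs i"
        using uniq[of "- vs (Suc i)" "vs i"] at(1) frm Vfr vs(2) i by auto
      then have "- s = s" using u(4,5) by (metis inner_minus_right)
      then show False using u(2) by simp
    qed
    then have lt: "\<beta> (Suc i) < \<beta> i + pi" using le by simp
    \<comment> \<open>Testing the supporting line at the point of the disc in direction
      \<open>u\<close> shows that its distance from the origin is at least \<open>r\<close>.\<close>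
    have "(r / norm u) *\<^sub>R u \<in> P" using r u(1) by (intro subsetD[OF r(2)]) simp
    then have "u \<bullet> ((r / norm u) *\<^sub>R u) \<le> s" by (rule u(3))
    then have "r * norm u \<le> s" using u(1) by (simp add: dot_square_norm power2_eq_square)
    then have "2 * r * tan ((\<beta> (Suc i) - \<beta> i) / 2) \<le> dist (vs i) (vs (Suc i))"
      by (intro two_tan_half_le_chord[OF at _ _ u(1,2,4,5)] \<beta>(1) i lt r(1))
    then show ?thesis using lt \<beta>(1)[OF i] by (simp add: d_def)
  qed
  have "(\<Sum>i<h. d i) = (\<beta> h - \<beta> 0) / 2"
    unfolding d_def by (simp flip: sum_divide_distrib add: sum_lessThan_telescope)
  then have "(\<Sum>i<h. d i) / real h = pi / card V" using \<beta>(4) h by (simp add: field_simps)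
  then have "real h * tan (pi / card V) \<le> (\<Sum>i<h. tan (d i))"
    using card_tan_le_sum_tan[OF h(2), of d] edge by auto
  then have "2 * r * (real h * tan (pi / card V)) \<le> 2 * r * (\<Sum>i<h. tan (d i))"
    using r(1) by (intro mult_left_mono) auto
  also have "\<dots> \<le> (\<Sum>i<h. dist (vs i) (vs (Suc i)))"
    unfolding sum_distrib_left using edge by (intro sum_mono) auto
  finally have lower: "card V * r * tan (pi / card V) \<le> (\<Sum>i<h. dist (vs i) (vs (Suc i)))"
    by (simp add: h algebra_simps)
  \<comment> \<open>The angles to be visited: the start, the \<open>h\<close> vertices with index
    shifted by one, and the antipode of the start. The last entry is not \<open>\<beta> h\<close>,
    which may exceed \<open>\<theta> 1\<close>.\<close>
  define \<alpha> where "\<alpha> i = (if i = 0 then \<theta> 0 else if i \<le> h then \<beta> (i - 1) else \<theta> 0 + pi)" for i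
  have step: "\<alpha> i \<le> \<alpha> (Suc i)" if "i < Suc h" for i
    using \<beta>(1)[of "i - 1"] \<beta>(2) \<beta>(3)[of "i - 1"] h(2) that
    by (cases i) (auto simp: \<alpha>_def less_imp_le)
  have "mono_on {..Suc h} \<alpha>"
  proof (rule mono_onI)
    fix i j assume "j \<in> {..Suc h}" "i \<le> j"
    from this(2,1) show "\<alpha> i \<le> \<alpha> j"
    proof (induction rule: dec_induct)
      case (step n)
      then show ?case using \<open>\<And>i. i < Suc h \<Longrightarrow> \<alpha> i \<le> \<alpha> (Suc i)\<close>[of n] by simp
    qed simp
  qed
  then obtain t where t: "mono_on {..Suc h} t" "t ` {..Suc h} \<subseteq> {0..1}" "\<forall>i\<le>Suc h. \<theta> (t i) = \<alpha> i"
    using IVT_mono_times[OF g(2), of "Suc h" \<alpha>] g(4) by (auto simp: \<alpha>_def)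
  \<comment> \<open>Equal angles mean equal points, because both lie on the frontier.\<close>
  have gt: "g (t i) = x" if "i \<le> Suc h" "x \<in> frontier P" "at_angle (\<alpha> i) x" for i x
  proof -
    have "t i \<in> {0..1}" using t(2) that by auto
    then show ?thesis using uniq[of "g (t i)" x] g(1,3) t(3) that by force
  qed
  have g0: "g 0 \<in> frontier P" "at_angle (\<theta> 0) (g 0)" using g(1,3) by auto
  have gt0: "g (t 0) = g 0" by (rule gt) (use g0 in \<open>auto simp: \<alpha>_def\<close>)
  have gth: "g (t (Suc h)) = - g 0" by (rule gt) (use g0 frm in \<open>auto simp: \<alpha>_def\<close>)
  have gti: "g (t (Suc i)) = vs i" if "i < h" for i
    by (rule gt) (use that vs Vfr in \<open>auto simp: \<alpha>_def\<close>)
  obtain m where m: "h = Suc m" using h(2) by (cases h) auto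
  have "(\<Sum>i<h. dist (vs i) (vs (Suc i))) = (\<Sum>i<m. dist (vs i) (vs (Suc i))) + dist (vs m) (- vs 0)"
    using vs(1) by (simp add: m)
  \<comment> \<open>The last side, ending at \<open>- vs 0\<close>, is replaced by a detour through
    \<open>- g 0\<close>. By symmetry the second leg has length \<open>dist (g 0) (vs 0)\<close>,
    the first leg of the polygon inscribed in the curve.\<close>
  also have "\<dots> \<le> (\<Sum>i<m. dist (vs i) (vs (Suc i))) + (dist (vs m) (- g 0) + dist (- g 0) (- vs 0))"
    by (intro add_left_mono dist_triangle)
  also have "\<dots> = dist (g 0) (vs 0) + (\<Sum>i<m. dist (vs i) (vs (Suc i))) + dist (vs m) (- g 0)"
    by (simp add: dist_norm norm_minus_commute)
  also have "\<dots> = (\<Sum>i<Suc h. dist (g (t i)) (g (t (Suc i))))"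
  proof -
    have split: "(\<Sum>i<Suc h. F i) = F 0 + (\<Sum>i<m. F (Suc i)) + F h" for F :: "nat \<Rightarrow> real"
      unfolding sum.lessThan_Suc_shift[of F h] unfolding m by simp
    have "g (t h) = vs m" using gti[of m] m by simp
    then show ?thesis
      unfolding split gth gt0 using gti[of 0] h(2) by (simp add: gti m)
  qed
  finally have "ereal (card V * r * tan (pi / card V)) \<le> ereal (\<Sum>i<Suc h. dist (g (t i)) (g (t (Suc i))))"
    using lower by simp
  also have "\<dots> \<le> curve_length g" by (rule curve_length_ge[OF t(1,2)])
  finally show ?thesis .
qed

text \<open>The lift is the imaginary part of a continuous logarithm, which exists because the
  parameter interval is contractible and \<open>g\<close> avoids \<open>0\<close>.\<close>

lemma path_angle_lift:
  assumes "path g" "0 \<notin> path_image g"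
  obtains \<theta> where "continuous_on {0..1} \<theta>" "\<And>t. t \<in> {0..1} \<Longrightarrow> at_angle (\<theta> t) (g t)"
proof -
  have "continuous_on {0..1} g" "\<And>t. t \<in> {0..1} \<Longrightarrow> g t \<noteq> 0"
    using assms by (auto simp: path_def path_image_def)
  moreover have "contractible {0..1::real}" by (simp add: convex_imp_contractible)
  ultimately obtain l where l: "continuous_on {0..1} l" "\<And>t. t \<in> {0..1} \<Longrightarrow> g t = exp (l t)"
    using continuous_logarithm_on_contractible by metis
  show thesis
  proof (rule that[of "\<lambda>t. Im (l t)"])
    show "at_angle (Im (l t)) (g t)" if "t \<in> {0..1}" for t
      using l(2)[OF that] by (simp add: at_angle_def norm_mult exp_eq_polar[of "l t"])
  qed (intro continuous_intros l)
qed

text \<open>The lifted angle changes by at least \<open>pi\<close> in absolute value: otherwise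
  \<open>\<theta> 1\<close> and \<open>\<theta> 0 + pi\<close> would be angles of \<open>g 1\<close>
  less than \<open>2 * pi\<close> apart, hence equal. A curve that turns clockwise is reversed
  first.\<close>

lemma antipodal_curve_length:
  fixes P :: "complex set" and r :: real
  assumes P: "convex P" "compact P" "0 \<in> interior P" "\<And>x. x \<in> P \<Longrightarrow> - x \<in> P"
    and V: "V = {v. v extreme_point_of P}" "finite V"
    and r: "0 \<le> r" "cball 0 r \<subseteq> P"
    and g: "path g" "path_image g \<subseteq> frontier P" "pathfinish g = - pathstart g"
  shows "ereal (card V * r * tan (pi / card V)) \<le> curve_length g"
proof -
  have "0 \<notin> path_image g" using g(2) P(3) by (auto simp: frontier_def)
  then obtain \<theta> where \<theta>: "continuous_on {0..1} \<theta>" "\<And>t. t \<in> {0..1} \<Longrightarrow> at_angle (\<theta> t) (g t)"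
    by (metis path_angle_lift g(1))
  have nz: "g 1 \<noteq> 0" using \<open>0 \<notin> path_image g\<close> by (auto simp: path_image_def)
  have "at_angle (\<theta> 1) (g 1)" "at_angle (\<theta> 0 + pi) (g 1)"
    using \<theta>(2)[of 0] \<theta>(2)[of 1] g(3) by (auto simp: pathstart_def pathfinish_def)
  then have "\<not> \<bar>\<theta> 1 - \<theta> 0\<bar> < pi"
    using at_angle_unique[of "\<theta> 1" "g 1" "\<theta> 0 + pi"] nz by (auto simp: abs_if split: if_splits)
  then consider "\<theta> 0 + pi \<le> \<theta> 1" | "\<theta> 1 + pi \<le> \<theta> 0" by linarith
  then show ?thesis
  proof cases
    case 1
    then show ?thesis
      using half_turn_curve_length[OF P V r _ \<theta>] g(2) by (auto simp: path_image_def)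
  next
    case 2
    have "continuous_on {0..1} (\<lambda>t. \<theta> (1 - t))"
      by (rule continuous_on_compose2[OF \<theta>(1)]) (auto intro!: continuous_intros)
    moreover have "at_angle (\<theta> (1 - t)) (reversepath g t)" if "t \<in> {0..1}" for t
      using \<theta>(2)[of "1 - t"] that by (simp add: reversepath_def)
    moreover have "reversepath g ` {0..1} \<subseteq> frontier P"
      using g(2) path_image_reversepath[of g] by (simp add: path_image_def)
    ultimately show ?thesis
      using half_turn_curve_length[OF P V r, of "reversepath g" "\<lambda>t. \<theta> (1 - t)"] 2
        curve_length_reversepath_le[of g] by auto
  qed
qed

section \<open>The lower bound for an arbitrary centre of symmetry\<close>

lemma minus_image_eq_uminus:
  fixes C :: "'a::real_vector set"
  assumes "(\<lambda>x. 2 *\<^sub>R c - x) ` C = C" "x \<in> (\<lambda>x. x - c) ` C"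
  shows "- x \<in> (\<lambda>x. x - c) ` C"
proof -
  obtain y where y: "y \<in> C" "x = y - c" using assms(2) by auto
  then have "2 *\<^sub>R c - y \<in> C" using assms(1) by blast
  moreover have "- x = (2 *\<^sub>R c - y) - c" by (simp add: y scaleR_2)
  ultimately show ?thesis by blast
qed

lemma geometric_dilation_ge:
  assumes "p \<in> C" "q \<in> C" "p \<noteq> q"
    and "\<And>g. arc g \<Longrightarrow> path_image g \<subseteq> C \<Longrightarrow> pathstart g = p \<Longrightarrow> pathfinish g = q \<Longrightarrow> ereal l \<le> curve_length g"
  shows "ereal (l / dist p q) \<le> geometric_dilation C"
proof -
  have "ereal l \<le> arc_dist C p q"
    unfolding arc_dist_def by (rule INF_greatest) (use assms(4) in auto)
  then have "ereal l / ereal (dist p q) \<le> arc_dist C p q / ereal (dist p q)"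
    by (rule ereal_divide_right_mono) (use assms(3) in simp)
  also have "\<dots> \<le> geometric_dilation C"
    unfolding geometric_dilation_def by (rule SUP_upper2[of "(p, q)"]) (use assms in auto)
  finally show ?thesis using assms(3) by simp
qed

lemma curve_length_minus: "curve_length (\<lambda>t. g t - c) = curve_length (g :: real \<Rightarrow> 'a::real_normed_vector)"
  by (simp add: curve_length_def dist_norm)

lemma centrally_symmetric_ngon_dilation_ge:
  assumes "convex_ngon n C" "centrally_symmetric C"
  shows "even n \<and> ereal (real n / 2 * tan (pi / real n)) \<le> geometric_dilation C"
proof -
  obtain P where P: "polytope P" "interior P \<noteq> {}" "card {v. v extreme_point_of P} = n" "C = frontier P"
    using assms(1) by (auto simp: convex_ngon_def)
  obtain c where c: "(\<lambda>x. 2 *\<^sub>R c - x) ` C = C" using assms(2) by (auto simp: centrally_symmetric_def)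
  define Q where "Q = (\<lambda>x. x - c) ` P"
  have Q_add: "Q = (+) (- c) ` P" by (simp add: Q_def image_def)
  have poly: "polytope Q" unfolding Q_add polytope_translation_eq by (rule P)
  have Q: "convex Q" "compact Q" "closed Q"
    using poly by (auto intro: polytope_imp_convex polytope_imp_compact polytope_imp_closed)
  have fr: "frontier Q = (\<lambda>x. x - c) ` C"
    unfolding Q_add P(4) frontier_translation by (simp add: image_def)
  have frm: "- x \<in> frontier Q" if "x \<in> frontier Q" for x
    using minus_image_eq_uminus[OF c] that unfolding fr by blast
  \<comment> \<open>The hypothesis concerns the boundary only; the symmetry passes to the region
    because a compact convex set is the convex hull of its frontier.\<close>
  have sym: "- x \<in> Q" if "x \<in> Q" for x
  proof -
    have hull: "Q = convex hull (frontier Q)" using Krein_Milman_frontier Q by blast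
    have "uminus ` frontier Q \<subseteq> frontier Q" using frm by blast
    then have "convex hull (uminus ` frontier Q) \<subseteq> convex hull (frontier Q)"
      by (rule hull_mono)
    then have "uminus ` (convex hull (frontier Q)) \<subseteq> convex hull (frontier Q)"
      by (simp only: convex_hull_linear_image[OF linear_uminus])
    then show ?thesis using that hull by blast
  qed
  have "interior Q \<noteq> {}" unfolding Q_add interior_translation using P(2) by simp
  then obtain y where y: "y \<in> interior Q" by blast
  \<comment> \<open>The centre is the midpoint of two interior points.\<close>
  then have "(1/2) *\<^sub>R y + (1/2) *\<^sub>R (- y) \<in> interior Q"
    using interior_uminus[OF sym] Q(1) by (intro convexD convex_interior) auto
  then have int: "0 \<in> interior Q" by simp
  define V where "V = {v. v extreme_point_of Q}"
  have "card V = n"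
    unfolding V_def Q_def extreme_points_of_translation_subtract using P(3)
    by (simp add: card_image inj_on_def)
  have finV: "finite V" unfolding V_def by (rule finite_polyhedron_extreme_points[OF polytope_imp_polyhedron[OF poly]])
  obtain h where "card V = 2 * h"
    using extreme_points_half_turn[OF Q(1,2) int sym V_def finV, of 0] by metis
  then have "even n" using \<open>card V = n\<close> by simp
  have "Q \<noteq> UNIV" using Q(2) not_compact_UNIV by blast
  then have "frontier Q \<noteq> {}" using int interior_subset by (intro frontier_not_empty) auto
  then obtain q where q: "q \<in> frontier Q" "\<And>x. x \<in> frontier Q \<Longrightarrow> norm q \<le> norm x"
    using distance_attains_inf[of "frontier Q" 0] by auto
  define r where "r = norm q"
  have "q \<noteq> 0" using q(1) int by (auto simp: frontier_def)
  then have r: "0 < r" by (simp add: r_def)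
  \<comment> \<open>A disc that misses the frontier and contains an interior point stays inside, by
    connectedness; its closure does so because \<open>Q\<close> is closed.\<close>
  have "ball 0 r \<inter> frontier Q = {}" using q(2) by (force simp: r_def)
  then have "ball 0 r \<subseteq> Q"
    using connected_Int_frontier[OF connected_ball, of 0 r Q] r int interior_subset[of Q]
      by (metis Diff_eq_empty_iff Int_iff centre_in_ball empty_iff subsetD)
  then have ball: "cball 0 r \<subseteq> Q" using closure_minimal[OF _ Q(3), of "ball 0 r"] r by simp
  have mem: "q + c \<in> C" "- q + c \<in> C" using q(1) frm[OF q(1)] unfolding fr by auto
  have "ereal (n * r * tan (pi / n) / dist (q + c) (- q + c)) \<le> geometric_dilation C"
  proof (rule geometric_dilation_ge[OF mem])
    show "q + c \<noteq> - q + c" using \<open>q \<noteq> 0\<close> by (simp add: equal_neg_zero)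
    fix g assume g: "arc g" "path_image g \<subseteq> C" "pathstart g = q + c" "pathfinish g = - q + c"
    have "path (\<lambda>t. g t - c)" using g(1) by (auto simp: arc_def path_def intro!: continuous_intros)
    moreover have "path_image (\<lambda>t. g t - c) \<subseteq> frontier Q"
      using g(2) unfolding fr by (auto simp: path_image_def)
    moreover have "pathfinish (\<lambda>t. g t - c) = - pathstart (\<lambda>t. g t - c)"
      using g(3,4) by (simp add: pathfinish_def pathstart_def)
    ultimately have "ereal (card V * r * tan (pi / card V)) \<le> curve_length (\<lambda>t. g t - c)"
      by (intro antipodal_curve_length[OF Q(1,2) int _ V_def finV less_imp_le[OF r] ball] sym)
    then show "ereal (n * r * tan (pi / n)) \<le> curve_length g"
      by (simp add: curve_length_minus \<open>card V = n\<close>)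
  qed
  moreover have "dist (q + c) (- q + c) = 2 * r"
  proof -
    have "q + c - (- q + c) = 2 *\<^sub>R q" by (simp add: scaleR_2)
    then show ?thesis unfolding dist_norm r_def by (simp only: norm_scaleR abs_numeral)
  qed
  ultimately show ?thesis using \<open>even n\<close> r by simp
qed

subsection \<open>The regular polygon\<close>

text \<open>Jordan's inequality: sine is concave here and lies above its chord.\<close>

lemma sin_ge_linear:
  assumes "0 \<le> x" "x \<le> pi / 2"
  shows "2 * x / pi \<le> sin x"
proof -
  have "convex_on {0..pi/2} (\<lambda>x::real. - sin x)"
    by (rule convex_on_realI[where f' = "\<lambda>x. - cos x"])
      (auto intro!: derivative_eq_intros cos_monotone_0_pi_le)
  from convex_onD[OF this, of "2 * x / pi" 0 "pi / 2"] show ?thesis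
    using assms by (simp add: field_simps)
qed

lemma affine_nonneg_between:
  fixes a b c w :: real
  assumes "0 \<le> a + b * - c" "0 \<le> a + b * c" "- c \<le> w" "w \<le> c"
  shows "0 \<le> a + b * w"
proof (cases "b \<ge> 0")
  case True
  then have "b * - c \<le> b * w" using assms by (intro mult_left_mono) auto
  then show ?thesis using assms by simp
next
  case False
  then have "b * c \<le> b * w" using assms by (intro mult_left_mono_neg) auto
  then show ?thesis using assms by simp
qed

text \<open>Two tangents of the unit circle, placed symmetrically about the real axis. The squares
  are those of the imaginary and the real part; the first is the square of a function affine in
  \<open>y - x\<close>.\<close>

lemma norm_tangent_points_diff:
  "(norm (cis \<kappa> * Complex 1 y - cis (- \<kappa>) * Complex 1 x))\<^sup>2
     = (2 * sin \<kappa> + (y - x) * cos \<kappa>)\<^sup>2 + ((x + y) * sin \<kappa>)\<^sup>2"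
  unfolding cmod_power2 by (simp add: power2_eq_square algebra_simps)

lemma curve_length_le_Lipschitz:
  assumes "L-lipschitz_on {0..1} g"
  shows "curve_length g \<le> ereal L"
  unfolding curve_length_def
proof (rule SUP_least, clarify)
  fix k :: nat and t :: "nat \<Rightarrow> real"
  assume t: "mono_on {..k} t" "t ` {..k} \<subseteq> {0..1}"
  have "(\<Sum>i<k. dist (g (t i)) (g (t (Suc i)))) \<le> (\<Sum>i<k. L * (t (Suc i) - t i))"
  proof (rule sum_mono)
    fix i assume i: "i \<in> {..<k}"
    then have "t i \<in> {0..1}" "t (Suc i) \<in> {0..1}" using t(2) by (auto simp: image_subset_iff)
    then have "dist (g (t i)) (g (t (Suc i))) \<le> L * dist (t i) (t (Suc i))"
      by (rule lipschitz_onD[OF assms])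
    also have "dist (t i) (t (Suc i)) = t (Suc i) - t i"
      using t(1) i by (auto simp: mono_on_def dist_real_def)
    finally show "dist (g (t i)) (g (t (Suc i))) \<le> L * (t (Suc i) - t i)" .
  qed
  also have "\<dots> = L * (t k - t 0)"
    by (simp add: sum_lessThan_telescope flip: sum_distrib_left)
  also have "\<dots> \<le> L * 1"
  proof (rule mult_left_mono)
    have "t k \<in> {0..1}" "t 0 \<in> {0..1}" using t(2) by (auto simp: image_subset_iff)
    then show "t k - t 0 \<le> 1" by simp
  qed (rule lipschitz_on_nonneg[OF assms])
  finally show "ereal (\<Sum>i<k. dist (g (t i)) (g (t (Suc i)))) \<le> ereal L" by simp
qed

text \<open>
  The regular polygon with \<open>n = 2 h\<close> sides circumscribed about the unit circle, parametrized by arc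
  length; \<open>t\<close> is half the side length, and the side with index \<open>k\<close> touches the circle at
  \<open>cis (2 * k * \<alpha>)\<close>.
\<close>

locale regular_polygon =
  fixes h :: nat
  assumes h: "2 \<le> h"
begin

definition \<alpha> :: real where "\<alpha> = pi / (2 * h)"
definition t :: real where "t = tan \<alpha>"
definition side :: "int \<Rightarrow> real \<Rightarrow> complex" where "side k y = cis (2 * of_int k * \<alpha>) * Complex 1 y"
text \<open>Side \<open>k\<close> occupies the half-open parameter interval from
  \<open>2 * t * k - t\<close> to \<open>2 * t * k + t\<close>, so the parameter
  \<open>2 * t * k\<close> belongs to its point of tangency.\<close>

definition index :: "real \<Rightarrow> int" where "index s = \<lfloor>(s + t) / (2 * t)\<rfloor>"
definition c :: "real \<Rightarrow> complex" where "c s = side (index s) (s - 2 * t * of_int (index s))"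

lemma \<alpha>: "0 < \<alpha>" "\<alpha> \<le> pi / 4" "\<alpha> < pi / 2" and h\<alpha>: "h * \<alpha> = pi / 2"
proof -
  have "4 \<le> real (2 * h)" using h by simp
  then have "pi / real (2 * h) \<le> pi / 4" by (intro divide_left_mono) auto
  then show "0 < \<alpha>" "\<alpha> \<le> pi / 4" "h * \<alpha> = pi / 2" using h by (auto simp: \<alpha>_def)
  then show "\<alpha> < pi / 2" using pi_gt_zero by linarith
qed

lemma cos\<alpha>: "0 < cos \<alpha>" using \<alpha> by (intro cos_gt_zero_pi) auto

lemma t: "0 < t" unfolding t_def using \<alpha> by (intro tan_gt_zero) auto

lemma ht: "pi / 2 \<le> h * t"
proof -
  have "sin \<alpha> / cos \<alpha> \<ge> \<alpha>"
  proof -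
    have "\<bar>\<alpha>\<bar> \<le> \<bar>tan \<alpha>\<bar>" using \<alpha> by (intro abs_tan_ge) auto
    then show ?thesis using \<alpha> t by (simp add: tan_def t_def)
  qed
  then have "h * \<alpha> \<le> h * t" by (intro mult_left_mono) (auto simp: t_def tan_def)
  then show ?thesis by (simp add: h\<alpha>)
qed

lemma sin_multiple_ge: "k \<le> h \<Longrightarrow> real k / h \<le> sin (k * \<alpha>)"
proof -
  assume k: "k \<le> h"
  have "k * \<alpha> \<le> h * \<alpha>" using k \<alpha> by (intro mult_right_mono) auto
  then have "2 * (k * \<alpha>) / pi \<le> sin (k * \<alpha>)" using \<alpha> h\<alpha> by (intro sin_ge_linear) auto
  then show ?thesis using h by (simp add: \<alpha>_def)
qed

text \<open>Both sides are affine in \<open>w\<close>, and at \<open>w = \<plusminus> 2 t\<close> the claim becomes Jordan's inequality.\<close>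
lemma chord_estimate:
  fixes k :: nat
  assumes w: "\<bar>w\<bar> \<le> 2 * t" and d: "0 \<le> 2 * real k * t + w" "2 * real k * t + w \<le> 2 * real h * t"
  shows "(2 * real k * t + w) / (h * t) \<le> 2 * sin (k * \<alpha>) + w * cos (k * \<alpha>)"
proof -
  \<comment> \<open>The difference of the two sides of the claim is
    \<open>a + b * w\<close>.\<close>
  define a where "a = 2 * sin (k * \<alpha>) - 2 * k / h"
  define b where "b = cos (k * \<alpha>) - 1 / (h * t)"
  \<comment> \<open>After multiplication by \<open>cos \<alpha>\<close>, the addition theorem turns
    the right end into Jordan's inequality for \<open>k + 1\<close>, weakened by
    \<open>cos \<alpha> \<le> 1\<close>. The left end leads to \<open>k - 1\<close> in the same
    way.\<close>
  have right: "0 \<le> a + b * (2 * t)" if "k + 1 \<le> h"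
  proof -
    have "sin (real (k + 1) * \<alpha>) = sin (k * \<alpha>) * cos \<alpha> + cos (k * \<alpha>) * sin \<alpha>"
      by (simp add: distrib_right sin_add)
    then have "(a + b * (2 * t)) * cos \<alpha> = 2 * (sin (real (k + 1) * \<alpha>) - real (k + 1) / h * cos \<alpha>)"
      using h t cos\<alpha> by (simp add: a_def b_def t_def tan_def field_simps)
    moreover have "real (k + 1) / h * cos \<alpha> \<le> sin (real (k + 1) * \<alpha>)"
      by (rule order_trans[OF mult_left_le sin_multiple_ge[OF that]]) auto
    ultimately have "0 \<le> (a + b * (2 * t)) * cos \<alpha>" by simp
    then show ?thesis using cos\<alpha> by (simp add: zero_le_mult_iff)
  qed
  have left: "0 \<le> a + b * - (2 * t)" if k: "1 \<le> k" "k \<le> h"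
  proof -
    obtain j where j: "k = Suc j" using k(1) by (cases k) auto
    have "sin (real j * \<alpha>) = sin (real k * \<alpha> - \<alpha>)" by (simp add: j algebra_simps)
    then have "sin (real j * \<alpha>) = sin (k * \<alpha>) * cos \<alpha> - cos (k * \<alpha>) * sin \<alpha>"
      by (simp only: sin_diff)
    moreover have "(a + b * - (2 * t)) * cos \<alpha>
        = 2 * (sin (k * \<alpha>) * cos \<alpha> - cos (k * \<alpha>) * sin \<alpha> - (real k - 1) / h * cos \<alpha>)"
      using h t cos\<alpha> by (simp add: a_def b_def t_def tan_def field_simps)
    ultimately have "(a + b * - (2 * t)) * cos \<alpha> = 2 * (sin (real j * \<alpha>) - real j / h * cos \<alpha>)"
      by (simp add: j)
    moreover have "real j / h * cos \<alpha> \<le> sin (real j * \<alpha>)"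
      by (rule order_trans[OF mult_left_le sin_multiple_ge]) (use k(2) j in auto)
    ultimately have "0 \<le> (a + b * - (2 * t)) * cos \<alpha>" by simp
    then show ?thesis using cos\<alpha> by (simp add: zero_le_mult_iff)
  qed
  have "2 * real k * t \<le> 2 * real h * t + 2 * t" using w d by linarith
  then have "real k * t \<le> real (h + 1) * t" by (simp add: algebra_simps)
  then have kh: "k \<le> h + 1" using t by simp
  have "0 \<le> a + b * w"
  proof -
    \<comment> \<open>For \<open>1 \<le> k < h\<close> the two ends settle the matter. Near the
      extremes \<open>d\<close> restricts \<open>w\<close>: to \<open>w \<ge> 0\<close> for
      \<open>k = 0\<close>, to \<open>w \<le> 0\<close> for \<open>k = h\<close>, and to
      \<open>w = - 2 * t\<close> for \<open>k = h + 1\<close>.\<close>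
    consider "k = 0" | "1 \<le> k" "k < h" | "k = h" | "k = h + 1" using kh by linarith
    then show ?thesis
    proof cases
      case 1
      have "1 / (h * t) \<le> 1" using ht pi_ge_two h t by (simp add: divide_simps)
      then show ?thesis using d 1 by (simp add: a_def b_def)
    next
      case 2
      then show ?thesis using affine_nonneg_between[OF left right, of w] w by auto
    next
      case 3
      then have "w \<le> 0" using d by simp
      moreover have "a + b * w = - w / (h * t)" using 3 h by (simp add: a_def b_def h\<alpha>)
      moreover have "0 \<le> - w / (h * t)"
        using calculation(1) h t by (intro divide_nonneg_pos) auto
      ultimately show ?thesis by (simp only:)
    next
      case 4
      then have "w = - 2 * t" using w d by (simp add: algebra_simps)
      then have "a + b * w = 2 * (sin (h * \<alpha> + \<alpha>) - cos (h * \<alpha> + \<alpha>) * t) - 2 * real h / h"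
        using 4 h t by (simp add: a_def b_def field_simps)
      also have "\<dots> = 2 * (cos \<alpha> + sin \<alpha> * t) - 2"
        using h by (simp add: h\<alpha> sin_add cos_add)
      also have "cos \<alpha> + sin \<alpha> * t = 1 / cos \<alpha>"
        using cos\<alpha> sin_cos_squared_add2[of \<alpha>] by (simp add: t_def tan_def field_simps power2_eq_square)
      finally have "a + b * w = 2 * (1 / cos \<alpha>) - 2" .
      moreover have "1 \<le> 1 / cos \<alpha>" using cos\<alpha> by simp
      ultimately show ?thesis by linarith
    qed
  qed
  moreover have "(2 * real k * t + w) / (h * t) = 2 * k / h + w / (h * t)" using h t by (simp add: field_simps)
  ultimately show ?thesis by (simp add: a_def b_def algebra_simps)
qed

lemma index_bounds: "- t \<le> s - 2 * t * of_int (index s)" "s - 2 * t * of_int (index s) < t"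
proof -
  have "of_int (index s) \<le> (s + t) / (2 * t)" "(s + t) / (2 * t) < of_int (index s) + 1"
    unfolding index_def by linarith+
  then show "- t \<le> s - 2 * t * of_int (index s)" "s - 2 * t * of_int (index s) < t"
    using t by (simp_all add: field_simps)
qed

lemma index_eq: "- t \<le> y \<Longrightarrow> y < t \<Longrightarrow> index (2 * t * of_int k + y) = k"
  unfolding index_def using t by (intro floor_unique) (auto simp: field_simps)

text \<open>Rotating back by \<open>(i + j) * \<alpha>\<close> makes the two touching points
  symmetric about the real axis; then the second square in \<open>norm_tangent_points_diff\<close>
  is dropped.\<close>

lemma dist_side:
  assumes "i \<le> j"
  shows "2 * sin (real_of_int (j - i) * \<alpha>) + (y - x) * cos (real_of_int (j - i) * \<alpha>) \<le> dist (side i x) (side j y)"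
proof -
  define \<kappa> where "\<kappa> = real_of_int (j - i) * \<alpha>"
  have j: "cis ((i + j) * \<alpha>) * cis \<kappa> = cis (2 * of_int j * \<alpha>)"
    and i: "cis ((i + j) * \<alpha>) * cis (- \<kappa>) = cis (2 * of_int i * \<alpha>)"
    unfolding cis_mult by (simp_all add: \<kappa>_def algebra_simps)
  have "side j y - side i x
      = cis ((i + j) * \<alpha>) * (cis \<kappa> * Complex 1 y - cis (- \<kappa>) * Complex 1 x)"
    unfolding side_def j[symmetric] i[symmetric] by (simp only: right_diff_distrib mult.assoc)
  then have "dist (side i x) (side j y) = norm (cis \<kappa> * Complex 1 y - cis (- \<kappa>) * Complex 1 x)"
    by (simp add: dist_norm norm_minus_commute[of "side i x"] norm_mult)
  then have "(2 * sin \<kappa> + (y - x) * cos \<kappa>)\<^sup>2 \<le> (dist (side i x) (side j y))\<^sup>2"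
    by (simp add: norm_tangent_points_diff)
  then show ?thesis unfolding \<kappa>_def by (rule power2_le_imp_le) simp
qed

text \<open>The perimeter is \<open>4 * h * t\<close>, so this compares chord and arc up to half the
  perimeter. Writing the arc as \<open>2 * k * t + w\<close>, with \<open>k\<close> the difference
  of the side indices, reduces it to \<open>dist_side\<close> and
  \<open>chord_estimate\<close>.\<close>

lemma dist_c_ge:
  assumes "\<bar>s' - s\<bar> \<le> 2 * real h * t"
  shows "\<bar>s' - s\<bar> / (h * t) \<le> dist (c s) (c s')"
proof -
  have main: "(s' - s) / (h * t) \<le> dist (c s) (c s')" if "s \<le> s'" "s' - s \<le> 2 * real h * t" for s s'
  proof -
    have le: "index s \<le> index s'"
      unfolding index_def using t that by (intro floor_mono divide_right_mono) auto
    define k where "k = nat (index s' - index s)"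
    have k: "real k = real_of_int (index s' - index s)" using le by (simp add: k_def)
    define w where "w = (s' - 2 * t * of_int (index s')) - (s - 2 * t * of_int (index s))"
    have d: "2 * real k * t + w = s' - s" by (simp add: k w_def algebra_simps)
    have "\<bar>w\<bar> \<le> 2 * t" using index_bounds[of s] index_bounds[of s'] unfolding w_def by linarith
    then have "(2 * real k * t + w) / (h * t) \<le> 2 * sin (k * \<alpha>) + w * cos (k * \<alpha>)"
      using d that by (intro chord_estimate) auto
    also have "\<dots> \<le> dist (c s) (c s')"
      using dist_side[OF le] unfolding c_def k w_def .
    finally show ?thesis unfolding d .
  qed
  show ?thesis
    using main[of s s'] main[of s' s] assms by (cases "s \<le> s'") (auto simp: dist_commute)
qed

lemma cis_vertex: "Complex 1 t = cis \<alpha> / cos \<alpha>" "Complex 1 (- t) = cis (- \<alpha>) / cos \<alpha>"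
  using cos\<alpha> by (auto simp: complex_eq_iff t_def tan_def)

text \<open>The definition covers the half-open interval. At the right end the index is already
  \<open>k + 1\<close>, but the two sides share that vertex.\<close>

lemma c_on_side:
  fixes k :: int
  assumes that: "\<bar>s - 2 * t * of_int k\<bar> \<le> t"
  shows "c s = side k (s - 2 * t * of_int k)"
proof (cases "s - 2 * t * of_int k = t")
  case False
  then have "index (2 * t * of_int k + (s - 2 * t * of_int k)) = k" using that by (intro index_eq) auto
  then show ?thesis by (simp add: c_def)
next
  case True
  then have s: "s = 2 * t * (k + 1) + (- t)" by (simp add: algebra_simps)
  have "index s = k + 1" using index_eq[of "- t" "k + 1"] t unfolding s by simp
  moreover have "side (k + 1) (- t) = side k t"
    unfolding side_def cis_vertex by (simp add: cis_mult algebra_simps)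
  ultimately show ?thesis using True by (simp add: c_def algebra_simps)
qed

text \<open>On each closed side \<open>c\<close> is an isometry, and finitely many sides cover
  \<open>{u..v}\<close>.\<close>

lemma lipschitz_c: "1-lipschitz_on {u..v} c"
proof (rule lipschitz_on_closed_Union)
  fix k :: int assume "k \<in> {index u..index v}"
  show "1-lipschitz_on {s. \<bar>s - 2 * t * of_int k\<bar> \<le> t} c"
  proof (rule lipschitz_onI)
    fix x y assume "x \<in> {s. \<bar>s - 2 * t * of_int k\<bar> \<le> t}" "y \<in> {s. \<bar>s - 2 * t * of_int k\<bar> \<le> t}"
    then have "c x - c y = cis (2 * of_int k * \<alpha>) * (\<i> * of_real (x - y))"
      by (simp add: c_on_side[of _ k] side_def complex_eq_iff algebra_simps)
    then show "dist (c x) (c y) \<le> 1 * dist x y"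
      by (simp add: dist_norm norm_mult flip: of_real_diff)
  qed simp
  show "closed {s. \<bar>s - 2 * t * of_int k\<bar> \<le> t}"
    by (intro closed_Collect_le continuous_intros)
next
  show "{u..v} \<subseteq> (\<Union>k\<in>{index u..index v}. {s. \<bar>s - 2 * t * of_int k\<bar> \<le> t})"
  proof
    fix s assume s: "s \<in> {u..v}"
    then have "index s \<in> {index u..index v}"
      unfolding index_def using t by (auto intro!: floor_mono divide_right_mono)
    moreover have "\<bar>s - 2 * t * of_int (index s)\<bar> \<le> t" using index_bounds[of s] by linarith
    ultimately show "s \<in> (\<Union>k\<in>{index u..index v}. {s. \<bar>s - 2 * t * of_int k\<bar> \<le> t})" by blast
  qed
qed auto

text \<open>Moving on by \<open>h\<close> sides rotates by
  \<open>2 * h * \<alpha> = pi\<close>.\<close>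

lemma c_add_half: "c (s + 2 * real h * t) = - c s"
proof -
  have 1: "\<bar>s - 2 * t * of_int (index s)\<bar> \<le> t" using index_bounds[of s] by linarith
  have 2: "s + 2 * real h * t - 2 * t * of_int (index s + int h) = s - 2 * t * of_int (index s)" by (simp add: algebra_simps)
  have "cis (2 * (index s + int h) * \<alpha>) = cis (2 * index s * \<alpha> + 2 * (h * \<alpha>))" by (simp add: algebra_simps)
  also have "\<dots> = - cis (2 * index s * \<alpha>)" by (simp add: h\<alpha> complex_eq_iff)
  finally have "side (index s + int h) (s - 2 * t * of_int (index s)) = - side (index s) (s - 2 * t * of_int (index s))"
    by (simp add: side_def)
  then show ?thesis
    using c_on_side[OF 1] c_on_side[of "s + 2 * real h * t" "index s + int h"] 1 unfolding 2 by simp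
qed

lemma c_periodic: "c (s + of_int m * (4 * real h * t)) = c s"
proof -
  have one: "c (s + 4 * real h * t) = c s" for s
    using c_add_half[of s] c_add_half[of "s + 2 * real h * t"] by (simp add: algebra_simps)
  have nat: "c (s + m * (4 * real h * t)) = c s" for m :: nat and s
  proof (induction m)
    case (Suc m)
    then show ?case using one[of "s + m * (4 * real h * t)"] by (simp add: algebra_simps)
  qed simp
  show ?thesis
  proof (cases "m \<ge> 0")
    case True
    then show ?thesis using nat[of s "nat m"] by simp
  next
    case False
    then show ?thesis using nat[of "s + m * (4 * real h * t)" "nat (- m)"] by (simp add: algebra_simps)
  qed
qed

text \<open>For each pair an arc of length at most \<open>D\<close> is exhibited, where
  \<open>D\<close> is the parameter distance around the shorter way; \<open>dist_c_ge\<close> then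
  bounds the quotient.\<close>

lemma geometric_dilation_c_le: "geometric_dilation (range c) \<le> ereal (h * t)"
  unfolding geometric_dilation_def
proof (rule SUP_least, clarify)
  fix s s0 assume ne: "c s \<noteq> c s0"
  define L where "L = 4 * real h * t"
  have L: "0 < L" using h t by (simp add: L_def)
  \<comment> \<open>Rounding selects the parameter \<open>s'\<close> of the second point that is
    nearest to \<open>s\<close> modulo the perimeter, hence at most half a perimeter away.\<close>
  define m where "m = round ((s - s0) / L)"
  define s' where "s' = s0 + of_int m * L"
  have cs': "c s' = c s0" unfolding s'_def L_def by (rule c_periodic)
  have "\<bar>(s - s0) / L - m\<bar> \<le> 1 / 2" unfolding m_def using of_int_round_abs_le[of "(s - s0) / L"] by (simp add: abs_minus_commute)
  then have "\<bar>(s - s0) / L - m\<bar> * L \<le> 1 / 2 * L" using L by (intro mult_right_mono) auto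
  also have "\<bar>(s - s0) / L - m\<bar> * L = \<bar>((s - s0) / L - m) * L\<bar>" using L by (simp add: abs_mult)
  also have "((s - s0) / L - m) * L = s - s'" using L unfolding s'_def by (simp add: field_simps)
  finally have d: "\<bar>s' - s\<bar> \<le> 2 * real h * t" by (simp add: L_def abs_minus_commute mult.commute mult.left_commute)
  define D where "D = \<bar>s' - s\<bar>"
  have "s' \<noteq> s" using ne cs' by auto
  then have D: "0 < D" by (simp add: D_def)
  define g where "g \<tau> = c (s + \<tau> * (s' - s))" for \<tau> :: real
  have lip: "D-lipschitz_on {0..1} g"
  proof (rule lipschitz_onI)
    fix x y :: real
    let ?x = "s + x * (s' - s)" and ?y = "s + y * (s' - s)"
    have "dist (c ?x) (c ?y) \<le> 1 * dist ?x ?y"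
      by (rule lipschitz_onD[OF lipschitz_c[of "min ?x ?y" "max ?x ?y"]]) auto
    also have "dist ?x ?y = D * dist x y"
      by (simp add: dist_real_def D_def flip: abs_mult left_diff_distrib) (simp add: mult.commute)
    finally show "dist (g x) (g y) \<le> D * dist x y" by (simp add: g_def)
  qed (use D in simp)
  \<comment> \<open>Two parameters of the arc differ by at most half the perimeter, so
    \<open>dist_c_ge\<close> separates their images.\<close>
  have "inj_on g {0..1}"
  proof (rule inj_onI, rule ccontr)
    fix x y :: real
    assume xy: "x \<in> {0..1}" "y \<in> {0..1}" "g x = g y" "x \<noteq> y"
    let ?x = "s + x * (s' - s)" and ?y = "s + y * (s' - s)"
    have eq: "\<bar>?y - ?x\<bar> = \<bar>y - x\<bar> * D" by (simp add: D_def flip: abs_mult left_diff_distrib)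
    have "\<bar>y - x\<bar> * D \<le> 1 * D" using xy D by (intro mult_right_mono) auto
    then have "\<bar>?y - ?x\<bar> / (h * t) \<le> dist (c ?x) (c ?y)"
      using d eq by (intro dist_c_ge) (simp add: D_def)
    also have "\<dots> = 0" using xy by (simp add: g_def)
    finally have "\<bar>y - x\<bar> * D \<le> 0" using h t unfolding eq by (simp add: divide_simps)
    then show False using xy(4) D by (simp add: mult_le_0_iff)
  qed
  then have arc: "arc g" using lipschitz_on_continuous_on[OF lip] by (simp add: arc_def path_def)
  have "arc_dist (range c) (c s) (c s0) \<le> curve_length g"
    unfolding arc_dist_def
    by (rule INF_lower) (use arc cs' in \<open>auto simp: g_def path_image_def pathstart_def pathfinish_def\<close>)
  also have "\<dots> \<le> ereal D" by (rule curve_length_le_Lipschitz[OF lip])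
  finally have "arc_dist (range c) (c s) (c s0) / ereal (dist (c s) (c s0)) \<le> ereal D / ereal (dist (c s) (c s0))"
    by (rule ereal_divide_right_mono) (use ne in simp)
  also have "\<dots> = ereal (D / dist (c s) (c s0))" using ne by simp
  also have "\<dots> \<le> ereal (h * t)"
  proof -
    have "D / (h * t) \<le> dist (c s) (c s0)" using dist_c_ge[OF d] by (simp add: D_def cs')
    then show ?thesis using ne h t by (simp add: field_simps)
  qed
  finally show "arc_dist (range c) (c s) (c s0) / ereal (dist (c s) (c s0)) \<le> ereal (h * t)" .
qed

section \<open>The convex region bounded by the regular polygon\<close>

definition V :: "complex set" where "V = (\<lambda>z. cis \<alpha> / cos \<alpha> * z) ` {z. z ^ (2 * h) = 1}"

text \<open>The vertices are roots of unity, turned by \<open>\<alpha>\<close> and scaled to the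
  circumradius \<open>1 / cos \<alpha>\<close>, so the count of the roots carries over.\<close>

lemma card_V: "finite V" "card V = 2 * h"
proof -
  have n: "0 < 2 * h" using h by simp
  show "finite V" unfolding V_def using finite_nth_roots[OF n, of 1] by simp
  have "inj (\<lambda>z. cis \<alpha> / cos \<alpha> * z)" using cos\<alpha> by (intro injI) simp
  then show "card V = 2 * h" unfolding V_def
    using card_roots_unity_eq[OF n] by (simp add: card_image inj_on_subset)
qed

lemma vertex_in_V: "cis ((2 * of_int k + 1) * \<alpha>) / cos \<alpha> \<in> V"
proof -
  have e: "real (2 * h) * (2 * of_int k * \<alpha>) = 2 * pi * of_int k"
    using h by (simp add: \<alpha>_def)
  have "cis (2 * of_int k * \<alpha>) ^ (2 * h) = cis (2 * pi * of_int k)"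
    unfolding Complex.DeMoivre e ..
  also have "\<dots> = 1" by simp
  finally have root: "cis (2 * of_int k * \<alpha>) ^ (2 * h) = 1" .
  have "(2 * of_int k + 1) * \<alpha> = \<alpha> + 2 * of_int k * \<alpha>" by (simp add: algebra_simps)
  then have "cis ((2 * of_int k + 1) * \<alpha>) / cos \<alpha> = cis \<alpha> / cos \<alpha> * cis (2 * of_int k * \<alpha>)"
    by (simp only: cis_mult times_divide_eq_left)
  then show ?thesis unfolding V_def using root by blast
qed

lemma V_cases:
  assumes "v \<in> V"
  obtains j :: int where "v = cis ((2 * of_int j + 1) * \<alpha>) / cos \<alpha>"
proof -
  obtain z where z: "v = cis \<alpha> / cos \<alpha> * z" "z ^ (2 * h) = 1" using assms by (auto simp: V_def)
  obtain j where "z = cis (2 * pi * real j / real (2 * h))"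
    using Complex.bij_betw_roots_unity[of "2 * h"] h z(2) by (auto simp: bij_betw_def)
  moreover have "\<alpha> + 2 * pi * real j / real (2 * h) = (2 * of_int (int j) + 1) * \<alpha>"
    using h by (simp add: \<alpha>_def field_simps)
  ultimately have "v = cis ((2 * of_int (int j) + 1) * \<alpha>) / cos \<alpha>"
    unfolding z(1) by (simp only: cis_mult times_divide_eq_left)
  then show thesis by (rule that)
qed

lemma norm_V: "v \<in> V \<Longrightarrow> norm v = 1 / cos \<alpha>"
  using cos\<alpha> by (auto elim!: V_cases simp: norm_divide)

text \<open>Reducing \<open>m\<close> modulo \<open>2 * h\<close> changes the angle by a multiple of
  \<open>2 * pi\<close>. For the remainder \<open>r\<close> the difference of the cosines is a
  product of sines at \<open>r * \<alpha>\<close> and \<open>(r + 1) * \<alpha>\<close>, both in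
  \<open>{0..pi}\<close>.\<close>

lemma cos_odd_multiple_le: "cos ((2 * of_int m + 1) * \<alpha>) \<le> cos \<alpha>"
proof -
  define r where "r = m mod (2 * int h)"
  define q where "q = m div (2 * int h)"
  have r: "0 \<le> r" "r < 2 * int h" using h by (auto simp: r_def)
  have "m = 2 * int h * q + r" by (simp add: q_def r_def)
  then have "(2 * of_int m + 1) * \<alpha> = (2 * of_int r + 1) * \<alpha> + 4 * q * (h * \<alpha>)" by (simp add: algebra_simps)
  also have "\<dots> = (2 * of_int r + 1) * \<alpha> + 2 * pi * q" by (simp add: h\<alpha>)
  finally have "cos ((2 * of_int m + 1) * \<alpha>) = cos ((2 * of_int r + 1) * \<alpha>)"
    by (simp add: cos_add)
  moreover have "cos \<alpha> - cos ((2 * of_int r + 1) * \<alpha>) = 2 * (sin ((r + 1) * \<alpha>) * sin (r * \<alpha>))"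
  proof -
    have "(\<alpha> + (2 * of_int r + 1) * \<alpha>) / 2 = (r + 1) * \<alpha>" "((2 * of_int r + 1) * \<alpha> - \<alpha>) / 2 = r * \<alpha>"
      by (simp_all add: field_simps)
    then show ?thesis by (simp only: cos_diff_cos)
  qed
  moreover have "0 \<le> sin (r * \<alpha>)" "0 \<le> sin ((r + 1) * \<alpha>)"
  proof -
    have b: "0 \<le> sin (x * \<alpha>)" if "0 \<le> x" "x \<le> 2 * h" for x :: real
    proof -
      have "x * \<alpha> \<le> 2 * real h * \<alpha>" using that \<alpha> by (intro mult_right_mono) auto
      then have "x * \<alpha> \<le> pi" using h\<alpha> by linarith
      moreover have "0 \<le> x * \<alpha>" using that \<alpha> by simp
      ultimately show ?thesis by (intro sin_ge_zero)
    qed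
    show "0 \<le> sin (r * \<alpha>)" "0 \<le> sin ((r + 1) * \<alpha>)" using b[of r] b[of "r + 1"] r by linarith+
  qed
  ultimately show ?thesis by (smt (verit) mult_nonneg_nonneg)
qed

lemma inner_normal_vertex_le: "v \<in> V \<Longrightarrow> cis (2 * of_int k * \<alpha>) \<bullet> v \<le> 1"
proof (elim V_cases)
  fix j :: int assume v: "v = cis ((2 * of_int j + 1) * \<alpha>) / cos \<alpha>"
  have "cis (2 * of_int k * \<alpha>) \<bullet> v = cos ((2 * of_int j + 1) * \<alpha> - 2 * of_int k * \<alpha>) / cos \<alpha>"
    unfolding v by (simp add: inner_complex_def cos_diff add_divide_distrib mult.commute)
  also have "(2 * of_int j + 1) * \<alpha> - 2 * of_int k * \<alpha> = (2 * (j - k) + 1) * \<alpha>" by (simp add: algebra_simps)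
  also have "cos \<dots> / cos \<alpha> \<le> 1" using cos_odd_multiple_le[of "j - k"] cos\<alpha> by simp
  finally show ?thesis .
qed

definition P where "P = convex hull V"

lemma P: "polytope P" "convex P" "compact P" "closed P"
  unfolding P_def using card_V
  by (auto simp: polytope_convex_hull finite_imp_compact_convex_hull compact_imp_closed)

lemma P_inner_normal: "x \<in> P \<Longrightarrow> cis (2 * of_int k * \<alpha>) \<bullet> x \<le> 1"
proof -
  have "P \<subseteq> {x. cis (2 * of_int k * \<alpha>) \<bullet> x \<le> 1}"
    unfolding P_def by (intro hull_minimal convex_halfspace_le) (use inner_normal_vertex_le in auto)
  then show "x \<in> P \<Longrightarrow> cis (2 * of_int k * \<alpha>) \<bullet> x \<le> 1" by blast
qed

text \<open>A point outside \<open>P\<close> could be separated from it. But some vertex has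
  direction within \<open>\<alpha>\<close> of \<open>- a\<close>, and as its norm is
  \<open>1 / cos \<alpha>\<close>, it reaches at least as far in that direction as any point of the
  unit disc.\<close>

lemma ball_subset_P: "ball 0 1 \<subseteq> P"
proof (rule ccontr)
  assume "\<not> ball 0 1 \<subseteq> P"
  then obtain z where z: "norm z < 1" "z \<notin> P" by (meson mem_ball_0 subsetI)
  obtain a b where ab: "a \<bullet> z < b" "\<And>x. x \<in> P \<Longrightarrow> b < a \<bullet> x"
    using separating_hyperplane_closed_point[OF P(2,4) z(2)] by metis
  obtain \<gamma> where \<gamma>: "at_angle \<gamma> (- a)" by (metis at_angle_exists)
  \<comment> \<open>Vertex angles are the odd multiples of \<open>\<alpha>\<close>; this
    \<open>k\<close> puts \<open>\<gamma>\<close> between \<open>2 * k * \<alpha>\<close> and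
    \<open>2 * (k + 1) * \<alpha>\<close>, around the odd multiple in the middle.\<close>
  define k where "k = \<lfloor>\<gamma> / (2 * \<alpha>)\<rfloor>"
  have "k \<le> \<gamma> / (2 * \<alpha>)" "\<gamma> / (2 * \<alpha>) < k + 1" unfolding k_def by linarith+
  then have "\<bar>\<gamma> - (2 * of_int k + 1) * \<alpha>\<bar> \<le> \<alpha>" using \<alpha> by (auto simp: field_simps abs_le_iff)
  then have "cos \<alpha> \<le> cos \<bar>\<gamma> - (2 * of_int k + 1) * \<alpha>\<bar>" using \<alpha> by (intro cos_monotone_0_pi_le) auto
  then have cos: "cos \<alpha> \<le> cos ((2 * of_int k + 1) * \<alpha> - \<gamma>)" by (simp add: cos_diff mult.commute abs_if split: if_splits)
  define v where "v = cis ((2 * of_int k + 1) * \<alpha>) / cos \<alpha>"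
  have vV: "v \<in> V" unfolding v_def by (rule vertex_in_V)
  have vP: "v \<in> P" using vV unfolding P_def by (rule hull_inc)
  have "at_angle ((2 * of_int k + 1) * \<alpha>) v"
    by (rule at_angleI[of _ "1 / cos \<alpha>"]) (use cos\<alpha> in \<open>auto simp: v_def\<close>)
  then have "(- a) \<bullet> v = norm a * (cos ((2 * of_int k + 1) * \<alpha> - \<gamma>) / cos \<alpha>)"
    using inner_at_angle[OF \<gamma>] norm_V[OF vV] by simp
  also have "\<dots> \<ge> norm a * 1" using cos cos\<alpha> by (intro mult_left_mono) auto
  finally have "norm a \<le> - (a \<bullet> v)" by simp
  moreover have "\<bar>a \<bullet> z\<bar> \<le> norm a * norm z" by (rule Cauchy_Schwarz_ineq2)
  moreover have "norm a * norm z \<le> norm a * 1" using z by (intro mult_left_mono) auto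
  ultimately show False using ab(1) ab(2)[OF vP] by linarith
qed

lemma zero_in_interior_P: "0 \<in> interior P"
  using interior_maximal[OF ball_subset_P] by auto

text \<open>All vertices lie on one circle whose disc contains \<open>P\<close>, and the tangent of
  that circle at \<open>v\<close> meets the disc in \<open>v\<close> only.\<close>

lemma extreme_points_P: "{v. v extreme_point_of P} = V"
proof (intro equalityI subsetI CollectI)
  show "v \<in> V" if "v \<in> {v. v extreme_point_of P}" for v
    using that extreme_point_of_convex_hull unfolding P_def by blast
next
  fix v assume v: "v \<in> V"
  have "V \<subseteq> cball 0 (1 / cos \<alpha>)" using norm_V by auto
  then have sub: "P \<subseteq> cball 0 (1 / cos \<alpha>)" unfolding P_def by (intro hull_minimal) auto
  have nv: "norm v = 1 / cos \<alpha>" using norm_V[OF v] .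
  have vP: "v \<in> P" using v unfolding P_def by (rule hull_inc)
  show "v extreme_point_of P"
  proof (rule extreme_point_of_Int_supporting_hyperplane_le)
    show "v \<bullet> x \<le> (norm v)\<^sup>2" if "x \<in> P" for x
    proof -
      have "v \<bullet> x \<le> norm v * norm x" by (rule norm_cauchy_schwarz)
      also have "\<dots> \<le> norm v * norm v" using subsetD[OF sub that] nv cos\<alpha> by (intro mult_left_mono) auto
      finally show ?thesis by (simp add: power2_eq_square)
    qed
    show "P \<inter> {x. v \<bullet> x = (norm v)\<^sup>2} = {v}"
    proof (intro equalityI subsetI)
      fix x assume x: "x \<in> P \<inter> {x. v \<bullet> x = (norm v)\<^sup>2}"
      then have "norm x \<le> norm v" using sub nv by auto
      then have "(norm x)\<^sup>2 \<le> (norm v)\<^sup>2" by (intro power_mono) auto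
      moreover have "(norm (x - v))\<^sup>2 = (norm x)\<^sup>2 - 2 * (v \<bullet> x) + (norm v)\<^sup>2"
        by (simp add: power2_norm_eq_inner inner_diff inner_commute)
      ultimately have "(norm (x - v))\<^sup>2 \<le> 0" using x by simp
      then show "x \<in> {v}" by simp
    qed (use vP in \<open>simp add: power2_norm_eq_inner\<close>)
  qed
qed

text \<open>The point is a convex combination of two neighbouring vertices, and it lies on the line
  through them, which supports \<open>P\<close>.\<close>

lemma c_in_frontier: "c s \<in> frontier P"
proof -
  define k where "k = index s"
  define y where "y = s - 2 * t * of_int k"
  have y: "- t \<le> y" "y < t" using index_bounds[of s] by (auto simp: y_def k_def)
  have cs: "c s = side k y" by (simp add: c_def k_def y_def)
  have "2 * of_int k * \<alpha> + \<alpha> = (2 * of_int k + 1) * \<alpha>"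
    "2 * of_int k * \<alpha> + - \<alpha> = (2 * of_int (k - 1) + 1) * \<alpha>"
    by (simp_all add: algebra_simps)
  then have ends: "side k t \<in> V" "side k (- t) \<in> V"
    using vertex_in_V[of k] vertex_in_V[of "k - 1"]
    unfolding side_def cis_vertex by (simp_all only: times_divide_eq_right cis_mult)
  have "c s = ((t + y) / (2 * t)) *\<^sub>R side k t + ((t - y) / (2 * t)) *\<^sub>R side k (- t)"
    using t unfolding cs side_def by (simp add: complex_eq_iff field_simps)
  also have "\<dots> \<in> P"
    using ends y t unfolding P_def
    by (intro convexD[OF convex_convex_hull]) (auto intro: hull_inc simp: field_simps)
  finally have "c s \<in> P" .
  moreover have "c s \<notin> interior P"
  proof
    assume "c s \<in> interior P"
    moreover have "interior P \<subseteq> interior {x. cis (2 * of_int k * \<alpha>) \<bullet> x \<le> 1}"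
      using P_inner_normal by (intro interior_mono) auto
    ultimately have "cis (2 * of_int k * \<alpha>) \<bullet> c s < 1" by auto
    moreover have "cis (2 * of_int k * \<alpha>) \<bullet> c s = 1"
      using sin_cos_squared_add[of "2 * of_int k * \<alpha>"]
      unfolding cs side_def inner_complex_def by (simp add: power2_eq_square algebra_simps)
    ultimately show False by simp
  qed
  ultimately show ?thesis using P(4) by (simp add: frontier_def)
qed

lemma frontier_P: "frontier P = range c"
proof (intro equalityI subsetI)
  fix x assume x: "x \<in> frontier P"
  obtain \<gamma> where \<gamma>: "at_angle \<gamma> x" by (metis at_angle_exists)
  \<comment> \<open>The side whose angular sector contains \<open>\<gamma>\<close>. The ray meets it
    at offset \<open>tan \<delta>\<close> from the point of tangency, and radial uniqueness
    identifies that point with \<open>x\<close>.\<close>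
  define k where "k = \<lfloor>(\<gamma> + \<alpha>) / (2 * \<alpha>)\<rfloor>"
  define \<delta> where "\<delta> = \<gamma> - 2 * of_int k * \<alpha>"
  have "k \<le> (\<gamma> + \<alpha>) / (2 * \<alpha>)" "(\<gamma> + \<alpha>) / (2 * \<alpha>) < k + 1" unfolding k_def by linarith+
  then have \<delta>: "- \<alpha> \<le> \<delta>" "\<delta> \<le> \<alpha>" using \<alpha> by (auto simp: \<delta>_def field_simps)
  have cos: "0 < cos \<delta>" using \<delta> \<alpha> by (intro cos_gt_zero_pi) auto
  have "tan (- \<alpha>) \<le> tan \<delta>" "tan \<delta> \<le> tan \<alpha>" by (rule tan_mono_le; use \<delta> \<alpha> in linarith)+
  then have "\<bar>tan \<delta>\<bar> \<le> t" by (simp add: t_def abs_le_iff)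
  then have "c (2 * t * of_int k + tan \<delta>) = side k (tan \<delta>)" using c_on_side[of "2 * t * of_int k + tan \<delta>" k] by simp
  also have "\<dots> = of_real (1 / cos \<delta>) * cis (2 * of_int k * \<alpha> + \<delta>)"
    using cos by (simp add: side_def complex_eq_iff tan_def cos_add sin_add field_simps)
  finally have "at_angle \<gamma> (c (2 * t * of_int k + tan \<delta>))"
    using cos by (intro at_angleI[of _ "1 / cos \<delta>"]) (auto simp: \<delta>_def)
  then have "x = c (2 * t * of_int k + tan \<delta>)"
    using frontier_radial_unique[OF P(2,4) zero_in_interior_P x c_in_frontier \<gamma>] by blast
  then show "x \<in> range c" by blast
qed (use c_in_frontier in auto)

lemma convex_ngon_c: "convex_ngon (2 * h) (range c)"
  unfolding convex_ngon_def
  using P(1) zero_in_interior_P card_V(2) extreme_points_P frontier_P by (intro exI[of _ P]) auto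

lemma centrally_symmetric_c: "centrally_symmetric (range c)"
proof -
  have "(\<lambda>x. - x) ` range c = range c"
  proof (intro equalityI subsetI)
    fix x assume "x \<in> (\<lambda>x. - x) ` range c"
    then obtain s where "x = - c s" by blast
    then have "x = c (s + 2 * real h * t)" by (simp only: c_add_half)
    then show "x \<in> range c" by blast
  next
    fix x assume "x \<in> range c"
    then obtain s where "x = c s" by blast
    then have "x = - c (s + 2 * real h * t)" by (simp only: c_add_half minus_minus)
    then show "x \<in> (\<lambda>x. - x) ` range c" by blast
  qed
  then show ?thesis unfolding centrally_symmetric_def by (intro exI[of _ 0]) simp
qed

end

theorem theorem10:
  shows "(\<forall>(n::nat) (C::complex set). convex_ngon n C \<and> centrally_symmetric C \<longrightarrow>
            even n \<and> geometric_dilation C \<ge> ereal (real n / 2 * tan (pi / real n)))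
       \<and> (\<forall>n::nat. even n \<and> n \<ge> 4 \<longrightarrow>
            (\<exists>C::complex set. convex_ngon n C \<and> centrally_symmetric C \<and>
               geometric_dilation C = ereal (real n / 2 * tan (pi / real n))))"
proof (intro conjI allI impI)
  fix n :: nat and C :: "complex set"
  assume "convex_ngon n C \<and> centrally_symmetric C"
  then show "even n" "ereal (real n / 2 * tan (pi / real n)) \<le> geometric_dilation C"
    using centrally_symmetric_ngon_dilation_ge by blast+
next
  fix n :: nat
  assume n: "even n \<and> n \<ge> 4"
  then obtain h where nh: "n = 2 * h" by (auto elim: evenE)
  interpret regular_polygon h by unfold_locales (use n nh in simp)
  have "convex_ngon n (range c)" using convex_ngon_c nh by simp
  moreover have "geometric_dilation (range c) \<le> ereal (real n / 2 * tan (pi / real n))"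
    using geometric_dilation_c_le by (simp add: nh t_def \<alpha>_def)
  \<comment> \<open>The reverse inequality is the general lower bound applied to this
    polygon.\<close>
  ultimately show "\<exists>C. convex_ngon n C \<and> centrally_symmetric C \<and>
      geometric_dilation C = ereal (real n / 2 * tan (pi / real n))"
    using centrally_symmetric_c centrally_symmetric_ngon_dilation_ge by (blast intro: antisym)
qed

end
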